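(* Let $\mathfrak{a}=\mathfrak a_0\oplus\mathfrak a_1$ be a Lie antialgebra over $\mathbb K$ such that the odd part $\mathfrak{a}_1$ spans the even part $\mathfrak{a}_0$ (i.e. $\mathfrak{a}_0$ is the linear span of the products $ab$ with $a,b\in\mathfrak{a}_1$). Let $\mathfrak{g}:=\mathfrak{g}_{\mathfrak{a}}$ be the adjoint Lie superalgebra associated to $\mathfrak{a}$. Then there is a two-sided ideal $\mathcal{I}_{\mathfrak{a}}$ of $\mathcal{U}(\mathfrak{g})$ such that $$\mathcal{U}(\mathfrak{a})\simeq\mathcal{U}(\mathfrak{g})/\mathcal{I}_{\mathfrak{a}}$$ as associative algebras.
   Context: $\mathbb{K}=\mathbb{R}$ or $\mathbb{C}$. A superalgebra is a (not necessarily associative) $\mathbb{Z}_2$-graded algebra $\mathfrak{a}=\mathfrak{a}_0\oplus\mathfrak{a}_1$; it is supercommutative if $a\cdot b=(-1)^{\bar a\bar b}b\cdot a$ for homogeneous $a,b$. A Lie antialgebra is a supercommutative superalgebra $\mathfrak{a}=\mathfrak{a}_0\oplus\mathfrak{a}_1$ such that, for all $x,x_i\in\mathfrak{a}_0$ and $y,y_i\in\mathfrak{a}_1$: (LA0) $x_1(x_2x_3)=(x_1x_2)x_3$; (LA1) $x_1(x_2y)=\frac12(x_1x_2)y$; (LA2) $x(y_1y_2)=(xy_1)y_2+y_1(xy_2)$; (LA3) $y_1(y_2y_3)+y_2(y_3y_1)+y_3(y_1y_2)=0$. Enveloping algebra of a Lie antialgebra: $\mathcal{U}(\mathfrak{a}):=\mathcal{T}(\mathfrak{a})/\langle\mathcal{P}\rangle$,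 where $\mathcal{T}(\mathfrak{a})=\bigoplus_{n\ge0}\mathfrak a^{\otimes n}$ is the (unital) tensor algebra and $\langle\mathcal{P}\rangle$ is the two-sided ideal generated by $\frac12(a\otimes b-b\otimes a)-ab$, $\ \frac12(a\otimes x+x\otimes a)-ax$, $\ x\otimes y-xy$, for $a,b\in\mathfrak{a}_1$, $x,y\in\mathfrak{a}_0$. Adjoint Lie superalgebra: $(\mathfrak{g}_{\mathfrak{a}})_1:=\mathfrak{a}_1$, $(\mathfrak{g}_{\mathfrak{a}})_0:=(\mathfrak{a}_1\otimes\mathfrak{a}_1)/\mathcal{S}$, where $\mathcal{S}$ is the linear subspace spanned by $\{a\otimes b-b\otimes a,\ ax\otimes b-a\otimes bx : a,b\in\mathfrak{a}_1,\ x\in\mathfrak{a}_0\}$; $a\odot b$ is the class of $a\otimes b$. The bracket is $[a,b]=a\odot b$, $[a\odot b,c]=-[c,a\odot b]=a(bc)+b(ac)$, $[a\odot b,c\odot d]=2a(bc)\odot d+2b(ad)\odot c$, for $a,b,c,d\in\mathfrak{a}_1$; this is a Lie superalgebra. Enveloping algebra of a Lie superalgebra (normalization used here): $\mathcal{U}(\mathfrak{g})$ is the quotient of the unital tensor algebra $\mathcal T(\mathfrak{g})$ by the two-sided ideal generated by $\frac12\big(x\otimes y-(-1)^{\bar x\bar y}y\otimes x\big)-[x,y]$ for homogeneous $x,y\in\mathfrak{g}$. *)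

theory Defs
  imports Complex_Main "HOL-Algebra.Algebra" "HOL-Algebra.Algebraic_Closure_Type"
    "HOL-Library.Poly_Mapping" "HOL-Library.Z2"
begin

section \<open>Linear algebra over a field given as a type\<close>

text \<open>
  The ground field is a type \<open>'k\<close> of class \<^class>\<open>field\<close>. Vector spaces and
  (possibly non-associative) algebras over it are \<^typ>\<open>('k, 'a) module\<close> records; the
  components \<^const>\<open>monoid.mult\<close> and \<^const>\<open>monoid.one\<close> of a record that only serves as a vector
  space, and \<^const>\<open>monoid.one\<close> of a non-unital algebra, are irrelevant.
\<close>

definition lin_span :: "('k::field, 'a, 'm) module_scheme \<Rightarrow> 'a set \<Rightarrow> 'a set" where
  "lin_span M S = \<Inter>{H. submodule H (ring_of_type_algebra :: 'k ring) M \<and> S \<subseteq> H}"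

text \<open>Quotient of a vector space by a subspace, and of an algebra by a two-sided ideal.\<close>

definition quot_alg ::
    "('k, 'a, 'm) module_scheme \<Rightarrow> 'a set \<Rightarrow> ('k, 'a set) module" where
  "quot_alg M N =
     ring.extend (M Quot N) (module.fields (\<lambda>c C. \<Union>x\<in>C. N +>\<^bsub>M\<^esub> (c \<odot>\<^bsub>M\<^esub> x)))"

definition alg_iso ::
    "('k, 'a, 'm) module_scheme \<Rightarrow> ('k, 'b, 'n) module_scheme \<Rightarrow> ('a \<Rightarrow> 'b) set" where
  "alg_iso A B = {h \<in> ring_iso A B. \<forall>c. \<forall>x\<in>carrier A. h (c \<odot>\<^bsub>A\<^esub> x) = c \<odot>\<^bsub>B\<^esub> h x}"

definition free_module :: "'x set \<Rightarrow> ('k::field, 'x \<Rightarrow>\<^sub>0 'k) module" where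
  "free_module B =
     \<lparr>carrier = {p. Poly_Mapping.keys p \<subseteq> B}, monoid.mult = undefined, monoid.one = undefined,
      ring.zero = 0, ring.add = (+), module.smult = (\<lambda>c. Poly_Mapping.map ((*) c))\<rparr>"

text \<open>The linear extension to the free module of a map \<open>f\<close> given on the basis.\<close>

definition lin_ext ::
    "('k::field, 'a, 'm) module_scheme \<Rightarrow> ('x \<Rightarrow> 'a) \<Rightarrow> ('x \<Rightarrow>\<^sub>0 'k) \<Rightarrow> 'a" where
  "lin_ext M f p =
     (\<Oplus>\<^bsub>M\<^esub>x\<in>Poly_Mapping.keys p. Poly_Mapping.lookup p x \<odot>\<^bsub>M\<^esub> f x)"


section \<open>Tensor products\<close>

definition bilinear_relations ::
    "('k::field, 'v, 'm) module_scheme \<Rightarrow> ('k, 'w, 'n) module_scheme \<Rightarrow> ('v \<times> 'w \<Rightarrow>\<^sub>0 'k) set"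
  where
  "bilinear_relations V W =
     (let e = (\<lambda>v w c. Poly_Mapping.single (v, w) c) in
      {e (v \<oplus>\<^bsub>V\<^esub> v') w 1 - e v w 1 - e v' w 1 | v v' w.
         v \<in> carrier V \<and> v' \<in> carrier V \<and> w \<in> carrier W} \<union>
      {e v (w \<oplus>\<^bsub>W\<^esub> w') 1 - e v w 1 - e v w' 1 | v w w'.
         v \<in> carrier V \<and> w \<in> carrier W \<and> w' \<in> carrier W} \<union>
      {e (c \<odot>\<^bsub>V\<^esub> v) w 1 - e v w c | c v w. v \<in> carrier V \<and> w \<in> carrier W} \<union>
      {e v (c \<odot>\<^bsub>W\<^esub> w) 1 - e v w c | c v w. v \<in> carrier V \<and> w \<in> carrier W})"

definition bilinear_span ::
    "('k::field, 'v, 'm) module_scheme \<Rightarrow> ('k, 'w, 'n) module_scheme \<Rightarrow> ('v \<times> 'w \<Rightarrow>\<^sub>0 'k) set"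
  where
  "bilinear_span V W = lin_span (free_module (carrier V \<times> carrier W)) (bilinear_relations V W)"

definition tensor_product ::
    "('k::field, 'v, 'm) module_scheme \<Rightarrow> ('k, 'w, 'n) module_scheme
      \<Rightarrow> ('k, ('v \<times> 'w \<Rightarrow>\<^sub>0 'k) set) module" where
  "tensor_product V W = quot_alg (free_module (carrier V \<times> carrier W)) (bilinear_span V W)"

definition pure_tensor ::
    "('k::field, 'v, 'm) module_scheme \<Rightarrow> ('k, 'w, 'n) module_scheme
      \<Rightarrow> 'v \<Rightarrow> 'w \<Rightarrow> ('v \<times> 'w \<Rightarrow>\<^sub>0 'k) set" where
  "pure_tensor V W v w =
     bilinear_span V W +>\<^bsub>free_module (carrier V \<times> carrier W)\<^esub> Poly_Mapping.single (v, w) 1"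


section \<open>Tensor algebra\<close>

text \<open>
  Lists wrapped as an additively written monoid under concatenation, so that the monoid
  algebra structure on finitely supported functions applies.
\<close>

datatype 'v fmonoid = Word (letters: "'v list")

instantiation fmonoid :: (type) monoid_add
begin

definition zero_fmonoid :: "'a fmonoid" where
  "0 = Word []"

definition plus_fmonoid :: "'a fmonoid \<Rightarrow> 'a fmonoid \<Rightarrow> 'a fmonoid" where
  "u + v = Word (letters u @ letters v)"

instance
  by standard (simp_all add: zero_fmonoid_def plus_fmonoid_def)

end

definition free_algebra ::
    "('k::field, 'v, 'm) module_scheme \<Rightarrow> ('k, 'v fmonoid \<Rightarrow>\<^sub>0 'k) module" where
  "free_algebra V =
     \<lparr>carrier = {p. \<forall>w\<in>Poly_Mapping.keys p. set (letters w) \<subseteq> carrier V},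
      monoid.mult = (*), monoid.one = 1, ring.zero = 0, ring.add = (+), module.smult = (\<lambda>c. Poly_Mapping.map ((*) c))\<rparr>"

text \<open>
  The words of length \<open>n\<close> modulo multilinearity in the letters span the \<open>n\<close>-th tensor power
  of \<open>V\<close>. All relations are homogeneous in the length, so dividing out the span of all of
  them at once yields the direct sum of the tensor powers, with concatenation as product.
\<close>

definition multilinear_relations ::
    "('k::field, 'v, 'm) module_scheme \<Rightarrow> ('v fmonoid \<Rightarrow>\<^sub>0 'k) set" where
  "multilinear_relations V =
     (let e = (\<lambda>u x v c. Poly_Mapping.single (Word (u @ [x] @ v)) c) in
      {e u (x \<oplus>\<^bsub>V\<^esub> y) v 1 - e u x v 1 - e u y v 1 | u x y v.
         x \<in> carrier V \<and> y \<in> carrier V \<and> set u \<subseteq> carrier V \<and> set v \<subseteq> carrier V} \<union>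
      {e u (c \<odot>\<^bsub>V\<^esub> x) v 1 - e u x v c | c u x v.
         x \<in> carrier V \<and> set u \<subseteq> carrier V \<and> set v \<subseteq> carrier V})"

definition multilinear_span ::
    "('k::field, 'v, 'm) module_scheme \<Rightarrow> ('v fmonoid \<Rightarrow>\<^sub>0 'k) set" where
  "multilinear_span V = lin_span (free_algebra V) (multilinear_relations V)"

definition tensor_algebra ::
    "('k::field, 'v, 'm) module_scheme \<Rightarrow> ('k, ('v fmonoid \<Rightarrow>\<^sub>0 'k) set) module" where
  "tensor_algebra V = quot_alg (free_algebra V) (multilinear_span V)"

definition tensor_emb ::
    "('k::field, 'v, 'm) module_scheme \<Rightarrow> 'v \<Rightarrow> ('v fmonoid \<Rightarrow>\<^sub>0 'k) set" where
  "tensor_emb V x = multilinear_span V +>\<^bsub>free_algebra V\<^esub> Poly_Mapping.single (Word [x]) 1"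


section \<open>Superalgebras and Lie antialgebras\<close>

record ('k, 'a) superalgebra = "('k, 'a) module" +
  grade :: "bit \<Rightarrow> 'a set"

definition koszul_sign :: "bit \<Rightarrow> bit \<Rightarrow> 'k::field" where
  "koszul_sign i j = (if i * j = 1 then -1 else 1)"

locale superalgebra = module "ring_of_type_algebra :: 'k ring" A
  for A :: "('k::field, 'a, 'm) superalgebra_scheme" (structure) +
  assumes mult_closed: "\<lbrakk>x \<in> carrier A; y \<in> carrier A\<rbrakk> \<Longrightarrow> x \<otimes> y \<in> carrier A"
    and mult_add_left: "\<lbrakk>x \<in> carrier A; y \<in> carrier A; z \<in> carrier A\<rbrakk> \<Longrightarrow>
          (x \<oplus> y) \<otimes> z = x \<otimes> z \<oplus> y \<otimes> z"
    and mult_add_right: "\<lbrakk>x \<in> carrier A; y \<in> carrier A; z \<in> carrier A\<rbrakk> \<Longrightarrow>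
          z \<otimes> (x \<oplus> y) = z \<otimes> x \<oplus> z \<otimes> y"
    and mult_smult_left: "\<lbrakk>x \<in> carrier A; y \<in> carrier A\<rbrakk> \<Longrightarrow>
          (c \<odot> x) \<otimes> y = c \<odot> (x \<otimes> y)"
    and mult_smult_right: "\<lbrakk>x \<in> carrier A; y \<in> carrier A\<rbrakk> \<Longrightarrow>
          x \<otimes> (c \<odot> y) = c \<odot> (x \<otimes> y)"
    and grade_submodule: "submodule (grade A i) (ring_of_type_algebra :: 'k ring) A"
    and grade_sum: "x \<in> carrier A \<Longrightarrow> \<exists>x\<^sub>0\<in>grade A 0. \<exists>x\<^sub>1\<in>grade A 1. x = x\<^sub>0 \<oplus> x\<^sub>1"
    and grade_disjoint: "grade A 0 \<inter> grade A 1 = {\<zero>}"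
    and grade_mult: "\<lbrakk>x \<in> grade A i; y \<in> grade A j\<rbrakk> \<Longrightarrow> x \<otimes> y \<in> grade A (i + j)"

locale supercommutative_superalgebra = superalgebra +
  assumes supercommute: "\<lbrakk>x \<in> grade A i; y \<in> grade A j\<rbrakk> \<Longrightarrow>
    x \<otimes> y = koszul_sign i j \<odot> (y \<otimes> x)"

locale lie_antialgebra = supercommutative_superalgebra +
  assumes LA0: "\<lbrakk>x\<^sub>1 \<in> grade A 0; x\<^sub>2 \<in> grade A 0; x\<^sub>3 \<in> grade A 0\<rbrakk> \<Longrightarrow>
          x\<^sub>1 \<otimes> (x\<^sub>2 \<otimes> x\<^sub>3) = (x\<^sub>1 \<otimes> x\<^sub>2) \<otimes> x\<^sub>3"
    and LA1: "\<lbrakk>x\<^sub>1 \<in> grade A 0; x\<^sub>2 \<in> grade A 0; y \<in> grade A 1\<rbrakk> \<Longrightarrow>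
          x\<^sub>1 \<otimes> (x\<^sub>2 \<otimes> y) = (1/2) \<odot> ((x\<^sub>1 \<otimes> x\<^sub>2) \<otimes> y)"
    and LA2: "\<lbrakk>x \<in> grade A 0; y\<^sub>1 \<in> grade A 1; y\<^sub>2 \<in> grade A 1\<rbrakk> \<Longrightarrow>
          x \<otimes> (y\<^sub>1 \<otimes> y\<^sub>2) = (x \<otimes> y\<^sub>1) \<otimes> y\<^sub>2 \<oplus> y\<^sub>1 \<otimes> (x \<otimes> y\<^sub>2)"
    and LA3: "\<lbrakk>y\<^sub>1 \<in> grade A 1; y\<^sub>2 \<in> grade A 1; y\<^sub>3 \<in> grade A 1\<rbrakk> \<Longrightarrow>
          y\<^sub>1 \<otimes> (y\<^sub>2 \<otimes> y\<^sub>3) \<oplus> y\<^sub>2 \<otimes> (y\<^sub>3 \<otimes> y\<^sub>1) \<oplus> y\<^sub>3 \<otimes> (y\<^sub>1 \<otimes> y\<^sub>2) = \<zero>"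


section \<open>Enveloping algebras\<close>

definition antialgebra_relations ::
    "('k::field, 'a, 'm) superalgebra_scheme \<Rightarrow> ('a fmonoid \<Rightarrow>\<^sub>0 'k) set set" where
  "antialgebra_relations A =
     (let T = tensor_algebra A; \<iota> = tensor_emb A in
      {(1/2) \<odot>\<^bsub>T\<^esub> (\<iota> a \<otimes>\<^bsub>T\<^esub> \<iota> b \<ominus>\<^bsub>T\<^esub> \<iota> b \<otimes>\<^bsub>T\<^esub> \<iota> a) \<ominus>\<^bsub>T\<^esub> \<iota> (a \<otimes>\<^bsub>A\<^esub> b) | a b.
         a \<in> grade A 1 \<and> b \<in> grade A 1} \<union>
      {(1/2) \<odot>\<^bsub>T\<^esub> (\<iota> a \<otimes>\<^bsub>T\<^esub> \<iota> x \<oplus>\<^bsub>T\<^esub> \<iota> x \<otimes>\<^bsub>T\<^esub> \<iota> a) \<ominus>\<^bsub>T\<^esub> \<iota> (a \<otimes>\<^bsub>A\<^esub> x) | a x.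
         a \<in> grade A 1 \<and> x \<in> grade A 0} \<union>
      {\<iota> x \<otimes>\<^bsub>T\<^esub> \<iota> y \<ominus>\<^bsub>T\<^esub> \<iota> (x \<otimes>\<^bsub>A\<^esub> y) | x y. x \<in> grade A 0 \<and> y \<in> grade A 0})"

definition antialgebra_enveloping ::
    "('k::field, 'a, 'm) superalgebra_scheme
      \<Rightarrow> ('k, ('a fmonoid \<Rightarrow>\<^sub>0 'k) set set) module" where
  "antialgebra_enveloping A =
     quot_alg (tensor_algebra A) (genideal (tensor_algebra A) (antialgebra_relations A))"

text \<open>For a Lie superalgebra \<open>G\<close>, the product of the record is the bracket.\<close>

definition lie_relations ::
    "('k::field, 'a, 'm) superalgebra_scheme \<Rightarrow> ('a fmonoid \<Rightarrow>\<^sub>0 'k) set set" where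
  "lie_relations G =
     (let T = tensor_algebra G; \<iota> = tensor_emb G in
      {(1/2) \<odot>\<^bsub>T\<^esub> (\<iota> x \<otimes>\<^bsub>T\<^esub> \<iota> y \<ominus>\<^bsub>T\<^esub> koszul_sign i j \<odot>\<^bsub>T\<^esub> (\<iota> y \<otimes>\<^bsub>T\<^esub> \<iota> x))
         \<ominus>\<^bsub>T\<^esub> \<iota> (x \<otimes>\<^bsub>G\<^esub> y) | x y i j. x \<in> grade G i \<and> y \<in> grade G j})"

definition lie_enveloping ::
    "('k::field, 'a, 'm) superalgebra_scheme
      \<Rightarrow> ('k, ('a fmonoid \<Rightarrow>\<^sub>0 'k) set set) module" where
  "lie_enveloping G =
     quot_alg (tensor_algebra G) (genideal (tensor_algebra G) (lie_relations G))"


section \<open>The adjoint Lie superalgebra\<close>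

definition odd_part ::
    "('k, 'a, 'm) superalgebra_scheme \<Rightarrow> ('k, 'a, 'm) superalgebra_scheme" where
  "odd_part A = A\<lparr>carrier := grade A 1\<rparr>"

definition odd_square ::
    "('k::field, 'a, 'm) superalgebra_scheme \<Rightarrow> ('k, ('a \<times> 'a \<Rightarrow>\<^sub>0 'k) set) module" where
  "odd_square A = tensor_product (odd_part A) (odd_part A)"

definition adjoint_relations ::
    "('k::field, 'a, 'm) superalgebra_scheme \<Rightarrow> ('a \<times> 'a \<Rightarrow>\<^sub>0 'k) set set" where
  "adjoint_relations A =
     (let t = pure_tensor (odd_part A) (odd_part A) in
      {t a b \<ominus>\<^bsub>odd_square A\<^esub> t b a | a b. a \<in> grade A 1 \<and> b \<in> grade A 1} \<union>
      {t (a \<otimes>\<^bsub>A\<^esub> x) b \<ominus>\<^bsub>odd_square A\<^esub> t a (b \<otimes>\<^bsub>A\<^esub> x) | a b x.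
         a \<in> grade A 1 \<and> b \<in> grade A 1 \<and> x \<in> grade A 0})"

definition adjoint_span ::
    "('k::field, 'a, 'm) superalgebra_scheme \<Rightarrow> ('a \<times> 'a \<Rightarrow>\<^sub>0 'k) set set" where
  "adjoint_span A = lin_span (odd_square A) (adjoint_relations A)"

definition adjoint_even ::
    "('k::field, 'a, 'm) superalgebra_scheme
      \<Rightarrow> ('k, ('a \<times> 'a \<Rightarrow>\<^sub>0 'k) set set) module" where
  "adjoint_even A = quot_alg (odd_square A) (adjoint_span A)"

definition odot ::
    "('k::field, 'a, 'm) superalgebra_scheme
      \<Rightarrow> 'a \<Rightarrow> 'a \<Rightarrow> ('a \<times> 'a \<Rightarrow>\<^sub>0 'k) set set" where
  "odot A a b = adjoint_span A +>\<^bsub>odd_square A\<^esub> pure_tensor (odd_part A) (odd_part A) a b"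

text \<open>
  An element \<open>\<alpha>\<close> of the even part is a coset of cosets, and \<open>\<Union>\<alpha>\<close> consists of the formal
  combinations \<open>p\<close> of pairs \<open>(a, b)\<close> that represent it, i.e. for which \<open>\<alpha>\<close> is the
  corresponding combination of the classes \<^term>\<open>odot A a b\<close>. The brackets below are the
  (bi)linear extensions of the formulas on these classes; for a Lie antialgebra, the axioms
  imply that the values do not depend on the representative chosen here.
\<close>

definition adjoint_rep :: "('a \<times> 'a \<Rightarrow>\<^sub>0 'k::zero) set set \<Rightarrow> ('a \<times> 'a \<Rightarrow>\<^sub>0 'k)" where
  "adjoint_rep \<alpha> = (SOME p. p \<in> \<Union>\<alpha>)"

definition bracket_even_odd ::
    "('k::field, 'a, 'm) superalgebra_scheme
      \<Rightarrow> ('a \<times> 'a \<Rightarrow>\<^sub>0 'k) set set \<Rightarrow> 'a \<Rightarrow> 'a" where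
  "bracket_even_odd A \<alpha> c =
     lin_ext A (\<lambda>(a, b). a \<otimes>\<^bsub>A\<^esub> (b \<otimes>\<^bsub>A\<^esub> c) \<oplus>\<^bsub>A\<^esub> b \<otimes>\<^bsub>A\<^esub> (a \<otimes>\<^bsub>A\<^esub> c)) (adjoint_rep \<alpha>)"

definition bracket_even_even ::
    "('k::field, 'a, 'm) superalgebra_scheme
      \<Rightarrow> ('a \<times> 'a \<Rightarrow>\<^sub>0 'k) set set \<Rightarrow> ('a \<times> 'a \<Rightarrow>\<^sub>0 'k) set set
      \<Rightarrow> ('a \<times> 'a \<Rightarrow>\<^sub>0 'k) set set" where
  "bracket_even_even A \<alpha> \<beta> =
     (let E = adjoint_even A in
      lin_ext E (\<lambda>(a, b).
        lin_ext E (\<lambda>(c, d).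
            2 \<odot>\<^bsub>E\<^esub> odot A (a \<otimes>\<^bsub>A\<^esub> (b \<otimes>\<^bsub>A\<^esub> c)) d
              \<oplus>\<^bsub>E\<^esub> 2 \<odot>\<^bsub>E\<^esub> odot A (b \<otimes>\<^bsub>A\<^esub> (a \<otimes>\<^bsub>A\<^esub> d)) c)
          (adjoint_rep \<beta>))
        (adjoint_rep \<alpha>))"

text \<open>The pair \<open>(\<alpha>, a)\<close> is the sum of the even element \<open>\<alpha>\<close> and the odd element \<open>a\<close>.\<close>

definition adjoint ::
    "('k::field, 'a, 'm) superalgebra_scheme
      \<Rightarrow> ('k, ('a \<times> 'a \<Rightarrow>\<^sub>0 'k) set set \<times> 'a) superalgebra" where
  "adjoint A =
     (let E = adjoint_even A in
      \<lparr>carrier = carrier E \<times> grade A 1,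
       monoid.mult = (\<lambda>(\<alpha>, a) (\<beta>, b).
         (bracket_even_even A \<alpha> \<beta> \<oplus>\<^bsub>E\<^esub> odot A a b,
          bracket_even_odd A \<alpha> b \<ominus>\<^bsub>A\<^esub> bracket_even_odd A \<beta> a)),
       monoid.one = undefined,
       ring.zero = (\<zero>\<^bsub>E\<^esub>, \<zero>\<^bsub>A\<^esub>),
       ring.add = (\<lambda>(\<alpha>, a) (\<beta>, b). (\<alpha> \<oplus>\<^bsub>E\<^esub> \<beta>, a \<oplus>\<^bsub>A\<^esub> b)),
       module.smult = (\<lambda>c (\<alpha>, a). (c \<odot>\<^bsub>E\<^esub> \<alpha>, c \<odot>\<^bsub>A\<^esub> a)),
       grade = (\<lambda>i. if i = 0 then carrier E \<times> {\<zero>\<^bsub>A\<^esub>} else {\<zero>\<^bsub>E\<^esub>} \<times> grade A 1)\<rparr>)"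

end

theory Submission
  imports Defs
begin

text \<open>
  Write \<open>[x, y]\<close> and \<open>{x, y}\<close> for half the commutator and half the anticommutator in an
  associative algebra. The relations of \<open>U(\<aa>)\<close> fix \<open>[a, b]\<close> for odd \<open>a, b\<close>, but leave
  \<open>{a, b}\<close> free. Sending an odd element \<open>a\<close> to itself and \<open>a \<odot> b\<close> to \<open>{a, b}\<close> respects the
  relations of the adjoint Lie superalgebra: since the even elements \<open>x\<close> and \<open>ab\<close> commute, the
  balancing relation is the identity \<open>{{a, x}, b} = {a, {x, b}} + [x, [a, b]]\<close>; the bracket of
  an even and an odd element is \<open>[{a, b}, c] = {a, [b, c]} + {b, [a, c]}\<close>; and the bracket of
  two even elements follows because \<open>[{a, b}, _]\<close> is a derivation, with (LA3) bringing the
  result into the stated form. The induced homomorphism \<open>U(\<gg>) \<rightarrow> U(\<aa>)\<close> hits the odd elements,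
  hence their commutators, which span the even part; so it is surjective, and the ideal is its
  kernel.
\<close>


section \<open>Linear spaces and their homomorphisms\<close>

lemma ring_of_type_algebra_simps [simp]:
  "carrier (ring_of_type_algebra :: 'k::field ring) = UNIV"
  "x \<otimes>\<^bsub>(ring_of_type_algebra :: 'k ring)\<^esub> y = x * y"
  "x \<oplus>\<^bsub>(ring_of_type_algebra :: 'k ring)\<^esub> y = x + y"
  "\<one>\<^bsub>(ring_of_type_algebra :: 'k ring)\<^esub> = 1"
  "\<zero>\<^bsub>(ring_of_type_algebra :: 'k ring)\<^esub> = 0"
  by (simp_all add: ring_of_type_algebra_def)

abbreviation linear_subspace :: "'a set \<Rightarrow> ('k::field, 'a, 'm) module_scheme \<Rightarrow> bool" where
  "linear_subspace H M \<equiv> submodule H (ring_of_type_algebra :: 'k ring) M"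

locale linear_space = module "ring_of_type_algebra :: 'k ring" M
  for M :: "('k::field, 'a, 'm) module_scheme" (structure)
begin

lemma scale_closed [simp, intro]: "x \<in> carrier M \<Longrightarrow> c \<odot> x \<in> carrier M"
  by (simp add: smult_closed)

lemma scale_add_left: "x \<in> carrier M \<Longrightarrow> (a + b) \<odot> x = a \<odot> x \<oplus> b \<odot> x"
  using smult_l_distr[of a b x] by simp

lemma scale_add_right:
  "x \<in> carrier M \<Longrightarrow> y \<in> carrier M \<Longrightarrow> a \<odot> (x \<oplus> y) = a \<odot> x \<oplus> a \<odot> y"
  by (simp add: smult_r_distr)

lemma scale_scale: "x \<in> carrier M \<Longrightarrow> a \<odot> (b \<odot> x) = (a * b) \<odot> x"
  using smult_assoc1[of a b x] by simp

lemma scale_one [simp]: "x \<in> carrier M \<Longrightarrow> 1 \<odot> x = x"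
  using smult_one[of x] by simp

lemma scale_zero_left [simp]: "x \<in> carrier M \<Longrightarrow> 0 \<odot> x = \<zero>"
  using smult_l_null[of x] by simp

lemma scale_two: "x \<in> carrier M \<Longrightarrow> 2 \<odot> x = x \<oplus> x"
  using scale_add_left[of x 1 1] by simp

lemma scale_minus_one: "x \<in> carrier M \<Longrightarrow> (- 1) \<odot> x = \<ominus> x"
  using scale_add_left[of x "-1" 1] by (simp add: M.minus_equality)

lemma scale_diff_right:
  "x \<in> carrier M \<Longrightarrow> y \<in> carrier M \<Longrightarrow> c \<odot> (x \<ominus> y) = c \<odot> x \<ominus> c \<odot> y"
  by (simp add: M.minus_eq smult_r_distr smult_r_minus)

lemma diff_eq_zero_iff [simp]:
  assumes "x \<in> carrier M" "y \<in> carrier M"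
  shows "x \<ominus> y = \<zero> \<longleftrightarrow> x = y"
  using M.minus_equality[of x "\<ominus> y"] assms by (auto simp: M.minus_eq M.r_neg)

lemma diff_diff_eq:
  assumes "x \<in> carrier M" "y \<in> carrier M" "z \<in> carrier M"
  shows "x \<ominus> y \<ominus> z = x \<ominus> (y \<oplus> z)"
  using assms by (simp add: M.minus_eq M.minus_add M.a_assoc)

lemma add_diff_add:
  assumes "x \<in> carrier M" "y \<in> carrier M" "z \<in> carrier M" "w \<in> carrier M"
  shows "(x \<oplus> y) \<ominus> (z \<oplus> w) = (x \<ominus> z) \<oplus> (y \<ominus> w)"
  using assms by (simp add: M.minus_eq M.minus_add M.a_ac)

lemma linear_subspaceI:
  assumes "H \<subseteq> carrier M" "\<zero> \<in> H" "\<And>x y. x \<in> H \<Longrightarrow> y \<in> H \<Longrightarrow> x \<oplus> y \<in> H"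
    and scale: "\<And>c x. x \<in> H \<Longrightarrow> c \<odot> x \<in> H"
  shows "linear_subspace H M"
proof (rule submoduleI)
  fix a assume "a \<in> H"
  then show "\<ominus> a \<in> H"
    using scale[of a "-1"] assms(1) by (simp add: scale_minus_one subset_iff)
qed (use assms in auto)

lemma linear_subspace_zero: "linear_subspace {\<zero>} M"
  by (rule linear_subspaceI) auto

end

lemma linear_subspaceD:
  assumes "linear_subspace H M"
  shows "H \<subseteq> carrier M" "\<zero>\<^bsub>M\<^esub> \<in> H" "x \<in> H \<Longrightarrow> y \<in> H \<Longrightarrow> x \<oplus>\<^bsub>M\<^esub> y \<in> H"
    and "x \<in> H \<Longrightarrow> c \<odot>\<^bsub>M\<^esub> x \<in> H" "x \<in> H \<Longrightarrow> \<ominus>\<^bsub>M\<^esub> x \<in> H"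
  using subgroup.subset[OF submodule.axioms(1)[OF assms]]
    subgroup.one_closed[OF submodule.axioms(1)[OF assms]]
    subgroup.m_closed[OF submodule.axioms(1)[OF assms]]
    subgroup.m_inv_closed[OF submodule.axioms(1)[OF assms]]
    submodule.smult_closed[OF assms]
  by (simp_all add: a_inv_def)

lemma linear_spaceI:
  fixes M :: "('k::field, 'a, 'm) module_scheme" (structure)
  assumes "abelian_group M"
    and "\<And>c x. x \<in> carrier M \<Longrightarrow> c \<odot> x \<in> carrier M"
    and "\<And>a b x. x \<in> carrier M \<Longrightarrow> (a + b) \<odot> x = a \<odot> x \<oplus> b \<odot> x"
    and "\<And>a x y. x \<in> carrier M \<Longrightarrow> y \<in> carrier M \<Longrightarrow> a \<odot> (x \<oplus> y) = a \<odot> x \<oplus> a \<odot> y"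
    and "\<And>a b x. x \<in> carrier M \<Longrightarrow> a \<odot> (b \<odot> x) = (a * b) \<odot> x"
    and "\<And>x. x \<in> carrier M \<Longrightarrow> 1 \<odot> x = x"
  shows "linear_space M"
  unfolding linear_space_def
  by (rule moduleI) (use assms in \<open>auto intro: cring_from_type_algebra\<close>)

lemma lin_span_superset: "S \<subseteq> lin_span M S"
  by (auto simp: lin_span_def)

lemma lin_span_minimal: "linear_subspace H M \<Longrightarrow> S \<subseteq> H \<Longrightarrow> lin_span M S \<subseteq> H"
  by (auto simp: lin_span_def)

lemma (in linear_space) lin_span_subspace:
  assumes "S \<subseteq> carrier M"
  shows "linear_subspace (lin_span M S) M"
proof (rule linear_subspaceI)
  show "lin_span M S \<subseteq> carrier M"
    by (rule lin_span_minimal[OF carrier_is_submodule assms])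
qed (auto simp: lin_span_def linear_subspaceD)

locale linear_hom = M: linear_space M + N: linear_space N
  for M :: "('k::field, 'a, 'm) module_scheme" and N :: "('k, 'b, 'n) module_scheme" +
  fixes f :: "'a \<Rightarrow> 'b"
  assumes hom_closed [simp]: "x \<in> carrier M \<Longrightarrow> f x \<in> carrier N"
    and hom_add [simp]:
      "x \<in> carrier M \<Longrightarrow> y \<in> carrier M \<Longrightarrow> f (x \<oplus>\<^bsub>M\<^esub> y) = f x \<oplus>\<^bsub>N\<^esub> f y"
    and hom_smult [simp]: "x \<in> carrier M \<Longrightarrow> f (c \<odot>\<^bsub>M\<^esub> x) = c \<odot>\<^bsub>N\<^esub> f x"

lemmas linear_homI = linear_hom.intro[OF _ _ linear_hom_axioms.intro]

sublocale linear_hom \<subseteq> abelian_group: abelian_group_hom M N f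
  by standard (auto simp: hom_def)

context linear_hom
begin

lemma hom_diff [simp]:
  "x \<in> carrier M \<Longrightarrow> y \<in> carrier M \<Longrightarrow> f (x \<ominus>\<^bsub>M\<^esub> y) = f x \<ominus>\<^bsub>N\<^esub> f y"
  by (simp add: a_minus_def)

lemma image_subspace: "linear_subspace (f ` carrier M) N"
proof (rule N.linear_subspaceI)
  show "\<zero>\<^bsub>N\<^esub> \<in> f ` carrier M"
    using imageI[OF M.zero_closed, of f] by simp
  show "x \<oplus>\<^bsub>N\<^esub> y \<in> f ` carrier M" if "x \<in> f ` carrier M" "y \<in> f ` carrier M" for x y
    using that by (auto simp flip: hom_add)
  show "c \<odot>\<^bsub>N\<^esub> x \<in> f ` carrier M" if "x \<in> f ` carrier M" for c x
    using that by (auto simp flip: hom_smult)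
qed auto

lemma vimage_subspace:
  assumes "linear_subspace H N"
  shows "linear_subspace {x \<in> carrier M. f x \<in> H} M"
  by (rule M.linear_subspaceI) (auto simp: linear_subspaceD[OF assms])

lemma image_lin_span_subset:
  assumes "linear_subspace H N" "S \<subseteq> carrier M" "f ` S \<subseteq> H"
  shows "f ` lin_span M S \<subseteq> H"
  using lin_span_minimal[OF vimage_subspace[OF assms(1)]] assms(2,3) by blast

lemma lin_span_zero:
  assumes "S \<subseteq> carrier M" "\<And>x. x \<in> S \<Longrightarrow> f x = \<zero>\<^bsub>N\<^esub>" "x \<in> lin_span M S"
  shows "f x = \<zero>\<^bsub>N\<^esub>"
  using image_lin_span_subset[OF N.linear_subspace_zero assms(1)] assms(2,3) by blast

end

lemma linear_hom_comp:
  assumes "linear_hom L M f" "linear_hom M N g"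
  shows "linear_hom L N (\<lambda>x. g (f x))"
proof -
  interpret f: linear_hom L M f by fact
  interpret g: linear_hom M N g by fact
  show ?thesis by (rule linear_homI) (simp_all add: f.M.linear_space_axioms g.N.linear_space_axioms)
qed

lemma linear_hom_cong:
  assumes "linear_hom M N f" "\<And>x. x \<in> carrier M \<Longrightarrow> g x = f x"
  shows "linear_hom M N g"
proof -
  interpret f: linear_hom M N f by fact
  show ?thesis
    by (rule linear_homI) (simp_all add: assms(2) f.M.linear_space_axioms f.N.linear_space_axioms)
qed

lemma equalizer_subspace:
  assumes "linear_hom M N f" "linear_hom M N g"
  shows "linear_subspace {x \<in> carrier M. f x = g x} M"
proof -
  interpret f: linear_hom M N f by fact
  interpret g: linear_hom M N g by fact
  show ?thesis by (rule f.M.linear_subspaceI) auto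
qed


section \<open>Associative algebras and their homomorphisms\<close>

locale assoc_algebra = linear_space A + ring A
  for A :: "('k::field, 'a, 'm) module_scheme" (structure) +
  assumes scale_mult_left: "x \<in> carrier A \<Longrightarrow> y \<in> carrier A \<Longrightarrow> (c \<odot> x) \<otimes> y = c \<odot> (x \<otimes> y)"
    and scale_mult_right: "x \<in> carrier A \<Longrightarrow> y \<in> carrier A \<Longrightarrow> x \<otimes> (c \<odot> y) = c \<odot> (x \<otimes> y)"
begin

lemma mult_left_linear: "y \<in> carrier A \<Longrightarrow> linear_hom A A (\<lambda>x. y \<otimes> x)"
  by (rule linear_homI) (simp_all add: linear_space_axioms r_distr scale_mult_right)

lemma mult_right_linear: "y \<in> carrier A \<Longrightarrow> linear_hom A A (\<lambda>x. x \<otimes> y)"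
  by (rule linear_homI) (simp_all add: linear_space_axioms l_distr scale_mult_left)

lemma ideal_subspace:
  assumes "ideal I A"
  shows "linear_subspace I A"
proof -
  interpret ideal I A by fact
  have "c \<odot> x \<in> I" if "x \<in> I" for c x
    using that I_l_closed[of x "c \<odot> \<one>"] by (simp add: scale_mult_left)
  then show ?thesis by (intro linear_subspaceI a_subset) auto
qed

end

locale assoc_subalgebra =
  submodule H "ring_of_type_algebra :: 'k ring" A + submonoid H A
  for H and A :: "('k::field, 'a, 'm) module_scheme"

lemmas assoc_subalgebra_subspace = assoc_subalgebra.axioms(1)
  and assoc_subalgebra_submonoid = assoc_subalgebra.axioms(2)

locale algebra_hom = A: assoc_algebra A + B: assoc_algebra B + linear_hom A B h
  for A :: "('k::field, 'a, 'm) module_scheme" and B :: "('k, 'b, 'n) module_scheme" and h +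
  assumes hom_mult [simp]:
      "x \<in> carrier A \<Longrightarrow> y \<in> carrier A \<Longrightarrow> h (x \<otimes>\<^bsub>A\<^esub> y) = h x \<otimes>\<^bsub>B\<^esub> h y"
    and hom_one [simp]: "h \<one>\<^bsub>A\<^esub> = \<one>\<^bsub>B\<^esub>"

sublocale algebra_hom \<subseteq> ring: ring_hom_ring A B h
  by standard (auto intro: ring_hom_memI)

context algebra_hom
begin

lemma genideal_zero:
  assumes "S \<subseteq> carrier A" "\<And>x. x \<in> S \<Longrightarrow> h x = \<zero>\<^bsub>B\<^esub>" "x \<in> genideal A S"
  shows "h x = \<zero>\<^bsub>B\<^esub>"
proof -
  have "S \<subseteq> a_kernel A B h"
    using assms(1,2) unfolding a_kernel_def' by blast
  then have "genideal A S \<subseteq> a_kernel A B h"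
    by (rule A.genideal_minimal[OF ring.kernel_is_ideal])
  then show ?thesis using assms(3) unfolding a_kernel_def' by blast
qed

lemma image_subalgebra: "assoc_subalgebra (h ` carrier A) B"
proof (intro assoc_subalgebra.intro image_subspace submonoid.intro)
  show "x \<otimes>\<^bsub>B\<^esub> y \<in> h ` carrier A" if "x \<in> h ` carrier A" "y \<in> h ` carrier A" for x y
    using that by (auto simp flip: hom_mult)
  show "\<one>\<^bsub>B\<^esub> \<in> h ` carrier A"
    using imageI[OF A.one_closed, of h] by simp
qed auto

lemma vimage_subalgebra:
  assumes "assoc_subalgebra H B"
  shows "assoc_subalgebra {x \<in> carrier A. h x \<in> H} A"
proof -
  interpret H: assoc_subalgebra H B by fact
  show ?thesis
    by (intro assoc_subalgebra.intro vimage_subspace assoc_subalgebra_subspace[OF assms])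
      (auto intro: submonoid.intro)
qed

end


section \<open>Quotients\<close>

lemma quot_alg_simps:
  "carrier (quot_alg M N) = a_rcosets\<^bsub>M\<^esub> N"
  "\<zero>\<^bsub>quot_alg M N\<^esub> = N"
  "\<one>\<^bsub>quot_alg M N\<^esub> = N +>\<^bsub>M\<^esub> \<one>\<^bsub>M\<^esub>"
  "C \<oplus>\<^bsub>quot_alg M N\<^esub> D = C <+>\<^bsub>M\<^esub> D"
  "C \<otimes>\<^bsub>quot_alg M N\<^esub> D = rcoset_mult M N C D"
  "c \<odot>\<^bsub>quot_alg M N\<^esub> C = (\<Union>x\<in>C. N +>\<^bsub>M\<^esub> (c \<odot>\<^bsub>M\<^esub> x))"
  by (simp_all add: quot_alg_def ring.extend_def module.fields_def FactRing_def)

locale quotient_space = linear_space M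
  for M :: "('k::field, 'a, 'm) module_scheme" (structure) +
  fixes N :: "'a set"
  assumes N_subspace: "linear_subspace N M"

sublocale quotient_space \<subseteq> abelian_subgroup N M
  by (rule abelian_subgroupI3[OF _ M.abelian_group_axioms])
     (use N_subspace submodule.axioms(1) in \<open>auto intro: additive_subgroupI\<close>)

context quotient_space
begin

abbreviation Q :: "('k, 'a set) module" where
  "Q \<equiv> quot_alg M N"

lemma quot_carrier: "carrier Q = (+>) N ` carrier M"
  by (auto simp: quot_alg_simps A_RCOSETS_def')

lemma coset_mem_quot [simp]: "x \<in> carrier M \<Longrightarrow> N +> x \<in> carrier Q"
  by (simp add: quot_carrier)

lemma mem_coset_iff: "x \<in> carrier M \<Longrightarrow> y \<in> carrier M \<Longrightarrow> y \<in> N +> x \<longleftrightarrow> y \<ominus> x \<in> N"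
  using a_rcos_module[of x y] by (simp add: M.minus_eq)

lemma coset_eq_iff:
  assumes "x \<in> carrier M" "y \<in> carrier M"
  shows "N +> x = N +> y \<longleftrightarrow> x \<ominus> y \<in> N"
  using mem_coset_iff[OF assms(2,1)] a_repr_independence'[of x y] a_rcos_self[OF assms(1)] assms
  by auto

lemma quot_memD:
  assumes "C \<in> carrier Q" "x \<in> C"
  shows "x \<in> carrier M" "C = N +> x"
proof -
  obtain y where y: "y \<in> carrier M" "C = N +> y" using assms(1) by (auto simp: quot_carrier)
  show "x \<in> carrier M" using y assms(2) a_elemrcos_carrier[OF y(1)] by simp
  show "C = N +> x" using y assms(2) a_repr_independence'[OF _ y(1)] by simp
qed

lemma quot_nonempty: "C \<in> carrier Q \<Longrightarrow> C \<noteq> {}"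
  using a_rcos_self by (auto simp: quot_carrier)

lemma coset_add: "x \<in> carrier M \<Longrightarrow> y \<in> carrier M \<Longrightarrow> (N +> x) \<oplus>\<^bsub>Q\<^esub> (N +> y) = N +> (x \<oplus> y)"
  by (simp add: quot_alg_simps a_rcos_sum)

lemma coset_smult:
  assumes "x \<in> carrier M"
  shows "c \<odot>\<^bsub>Q\<^esub> (N +> x) = N +> (c \<odot> x)"
proof -
  have "N +> (c \<odot> y) = N +> (c \<odot> x)" if y: "y \<in> N +> x" for y
  proof -
    have y_closed: "y \<in> carrier M" by (rule a_elemrcos_carrier[OF assms y])
    have "c \<odot> (y \<ominus> x) \<in> N"
      using y mem_coset_iff[OF assms y_closed] by (auto intro: linear_subspaceD(4)[OF N_subspace])
    then show ?thesis using y_closed assms by (simp add: coset_eq_iff scale_diff_right)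
  qed
  then have "(\<Union>y\<in>N +> x. N +> (c \<odot> y)) = N +> (c \<odot> x)"
    using a_rcos_self[OF assms] by (intro SUP_eq_const) blast+
  then show ?thesis by (simp add: quot_alg_simps)
qed

lemma quot_zero: "\<zero>\<^bsub>Q\<^esub> = N +> \<zero>"
  using a_coset_add_zero[OF a_subset] by (simp add: quot_alg_simps)

lemma quot_linear_space: "linear_space Q"
proof (rule linear_spaceI)
  show "abelian_group Q"
  proof (rule abelian_groupI)
    fix C assume "C \<in> carrier Q"
    then obtain x where x: "x \<in> carrier M" "C = N +> x" by (auto simp: quot_carrier)
    then show "\<exists>D\<in>carrier Q. D \<oplus>\<^bsub>Q\<^esub> C = \<zero>\<^bsub>Q\<^esub>"
      by (intro bexI[of _ "N +> \<ominus> x"]) (simp_all add: quot_zero coset_add M.l_neg)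
  qed (auto simp: quot_carrier quot_zero coset_add M.a_ac)
qed (auto simp: quot_carrier coset_add coset_smult scale_add_left scale_add_right scale_scale)

lemma coset_linear_hom: "linear_hom M Q ((+>) N)"
  by (rule linear_homI)
    (simp_all add: linear_space_axioms quot_linear_space coset_add coset_smult)

lemma coset_eq_zero: "x \<in> N \<Longrightarrow> N +> x = \<zero>\<^bsub>Q\<^esub>"
  by (simp add: quot_alg_simps a_rcos_const)

lemma quot_lift:
  assumes "linear_hom M B f" and vanish: "\<And>x. x \<in> N \<Longrightarrow> f x = \<zero>\<^bsub>B\<^esub>"
  obtains g where "linear_hom Q B g" "\<And>x. x \<in> carrier M \<Longrightarrow> g (N +> x) = f x"
proof
  interpret f: linear_hom M B f by fact
  let ?g = "\<lambda>C. the_elem (f ` C)"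
  show lift: "?g (N +> x) = f x" if x: "x \<in> carrier M" for x
  proof (rule the_elem_image_unique)
    show "f y = f x" if y: "y \<in> N +> x" for y
    proof -
      have y_closed: "y \<in> carrier M" by (rule a_elemrcos_carrier[OF x y])
      then have "f (y \<ominus> x) = \<zero>\<^bsub>B\<^esub>" using y mem_coset_iff[OF x] by (intro vanish) blast
      then show ?thesis using x y_closed by simp
    qed
  qed (use a_rcos_self[OF x] in blast)
  show "linear_hom Q B ?g"
  proof (rule linear_homI[OF quot_linear_space f.N.linear_space_axioms])
    fix C assume "C \<in> carrier Q"
    then obtain x where x: "x \<in> carrier M" "C = N +> x" by (auto simp: quot_carrier)
    then show "?g C \<in> carrier B" "\<And>c. ?g (c \<odot>\<^bsub>Q\<^esub> C) = c \<odot>\<^bsub>B\<^esub> ?g C"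
      by (simp_all add: coset_smult lift)
    fix D assume "D \<in> carrier Q"
    then obtain y where "y \<in> carrier M" "D = N +> y" by (auto simp: quot_carrier)
    with x show "?g (C \<oplus>\<^bsub>Q\<^esub> D) = ?g C \<oplus>\<^bsub>B\<^esub> ?g D" by (simp add: coset_add lift)
  qed
qed

end

locale quotient_algebra = assoc_algebra A + ideal N A
  for A :: "('k::field, 'a, 'm) module_scheme" (structure) and N

sublocale quotient_algebra \<subseteq> quotient_space A N
  by (intro quotient_space.intro linear_space_axioms quotient_space_axioms.intro
      ideal_subspace ideal_axioms)

context quotient_algebra
begin

lemma coset_mult: "x \<in> carrier A \<Longrightarrow> y \<in> carrier A \<Longrightarrow> (N +> x) \<otimes>\<^bsub>Q\<^esub> (N +> y) = N +> (x \<otimes> y)"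
  by (simp add: quot_alg_simps rcoset_mult_add)

lemma quot_one: "\<one>\<^bsub>Q\<^esub> = N +> \<one>"
  by (simp add: quot_alg_simps)

lemma quot_assoc_algebra: "assoc_algebra Q"
proof (intro assoc_algebra.intro quot_linear_space assoc_algebra_axioms.intro ringI monoidI)
  show "abelian_group Q"
    using linear_space.axioms[OF quot_linear_space] by (rule module.axioms)
qed (auto simp: quot_carrier quot_one coset_mult coset_add coset_smult
    m_assoc l_distr r_distr scale_mult_left scale_mult_right)

lemma coset_algebra_hom: "algebra_hom A Q ((+>) N)"
  by (intro algebra_hom.intro algebra_hom_axioms.intro assoc_algebra_axioms
      quot_assoc_algebra coset_linear_hom) (simp_all add: coset_mult quot_one)

lemma quot_algebra_lift:
  assumes "algebra_hom A B f" "\<And>x. x \<in> N \<Longrightarrow> f x = \<zero>\<^bsub>B\<^esub>"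
  obtains g where "algebra_hom Q B g" "\<And>x. x \<in> carrier A \<Longrightarrow> g (N +> x) = f x"
proof -
  interpret f: algebra_hom A B f by fact
  obtain g where g: "linear_hom Q B g" "\<And>x. x \<in> carrier A \<Longrightarrow> g (N +> x) = f x"
    using quot_lift[OF f.linear_hom_axioms assms(2)] by blast
  have "algebra_hom Q B g"
    by (intro algebra_hom.intro algebra_hom_axioms.intro quot_assoc_algebra g(1)
        f.B.assoc_algebra_axioms) (auto simp: quot_carrier coset_mult quot_one g(2))
  then show thesis using g(2) by (rule that)
qed

end

lemma (in algebra_hom) first_isomorphism:
  assumes surj: "h ` carrier A = carrier B"
  obtains I g where "ideal I A" "g \<in> alg_iso B (quot_alg A I)"
proof -
  define I where "I = a_kernel A B h"
  have I: "ideal I A" unfolding I_def by (rule ring.kernel_is_ideal)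
  interpret quotient_algebra A I
    by (intro quotient_algebra.intro A.assoc_algebra_axioms I)
  interpret Q: assoc_algebra Q by (rule quot_assoc_algebra)
  define k where "k C = the_elem (h ` C)" for C
  have "k \<in> ring_iso (A Quot I) B"
    unfolding I_def k_def by (rule ring.FactRing_iso_set[OF surj])
  then have k: "k \<in> ring_iso Q B"
    by (simp add: ring_iso_def ring_hom_def quot_alg_simps FactRing_def)
  have coset: "k (I +>\<^bsub>A\<^esub> x) = h x" if "x \<in> carrier A" for x
    unfolding k_def I_def using that by (rule ring.the_elem_simp)
  have bij: "bij_betw k (carrier Q) (carrier B)" by (rule ring_iso_memE(5)[OF k])
  have "inv_into (carrier Q) k (c \<odot>\<^bsub>B\<^esub> y) = c \<odot>\<^bsub>Q\<^esub> inv_into (carrier Q) k y"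
    if y: "y \<in> carrier B" for c y
  proof -
    obtain x where x: "x \<in> carrier A" "y = k (I +>\<^bsub>A\<^esub> x)"
      using y surj coset by (metis imageE)
    then have "c \<odot>\<^bsub>B\<^esub> y = k (c \<odot>\<^bsub>Q\<^esub> (I +>\<^bsub>A\<^esub> x))" by (simp add: coset coset_smult)
    then show ?thesis
      using x by (simp add: bij_betw_inv_into_left[OF bij])
  qed
  then have "inv_into (carrier Q) k \<in> alg_iso B Q"
    using ring_iso_set_sym[OF Q.ring_axioms k] by (simp add: alg_iso_def)
  with I show thesis by (rule that)
qed


section \<open>Finitely supported functions and linear extensions\<close>

lemma lookup_map_times [simp]:
  "Poly_Mapping.lookup (Poly_Mapping.map ((*) (c::'k::field)) p) k = c * Poly_Mapping.lookup p k"
  by (simp add: map.rep_eq when_def)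

lemma keys_map_times:
  "Poly_Mapping.keys (Poly_Mapping.map ((*) (c::'k::field)) p) \<subseteq> Poly_Mapping.keys p"
  by (auto simp: in_keys_iff)

lemma map_times_poly_mapping:
  fixes c :: "'k::field"
  shows "Poly_Mapping.map ((*) (c + d)) p = Poly_Mapping.map ((*) c) p + Poly_Mapping.map ((*) d) p"
    and "Poly_Mapping.map ((*) c) (p + q) = Poly_Mapping.map ((*) c) p + Poly_Mapping.map ((*) c) q"
    and "Poly_Mapping.map ((*) c) (Poly_Mapping.map ((*) d) p) = Poly_Mapping.map ((*) (c * d)) p"
    and "Poly_Mapping.map ((*) 1) p = p"
    and "Poly_Mapping.map ((*) c) (Poly_Mapping.single k d) = Poly_Mapping.single k (c * d)"
  by (auto intro!: poly_mapping_eqI simp: lookup_add algebra_simps lookup_single when_def)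

context linear_space
begin

lemma lin_ext_superset:
  assumes "finite F" "Poly_Mapping.keys p \<subseteq> F" "f \<in> F \<rightarrow> carrier M"
  shows "lin_ext M f p = (\<Oplus>x\<in>F. Poly_Mapping.lookup p x \<odot> f x)"
  unfolding lin_ext_def
  by (rule M.add.finprod_mono_neutral_cong_left) (use assms in \<open>auto simp: in_keys_iff Pi_iff\<close>)

lemma lin_ext_closed: "f \<in> Poly_Mapping.keys p \<rightarrow> carrier M \<Longrightarrow> lin_ext M f p \<in> carrier M"
  unfolding lin_ext_def by (rule M.finsum_closed) auto

lemma lin_ext_cong:
  assumes "\<And>x. x \<in> Poly_Mapping.keys p \<Longrightarrow> f x = g x" "g \<in> Poly_Mapping.keys p \<rightarrow> carrier M"
  shows "lin_ext M f p = lin_ext M g p"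
  unfolding lin_ext_def using assms by (intro M.finsum_cong') auto

lemma lin_ext_single: "f k \<in> carrier M \<Longrightarrow> lin_ext M f (Poly_Mapping.single k c) = c \<odot> f k"
  using lin_ext_superset[of "{k}" "Poly_Mapping.single k c" f] by simp

lemma lin_ext_add:
  assumes "f \<in> Poly_Mapping.keys p \<union> Poly_Mapping.keys q \<rightarrow> carrier M"
  shows "lin_ext M f (p + q) = lin_ext M f p \<oplus> lin_ext M f q"
proof -
  let ?F = "Poly_Mapping.keys p \<union> Poly_Mapping.keys q"
  have "lin_ext M f (p + q) = (\<Oplus>x\<in>?F. Poly_Mapping.lookup (p + q) x \<odot> f x)"
    by (rule lin_ext_superset) (use assms keys_add[of p q] in auto)
  also have "\<dots> = (\<Oplus>x\<in>?F. Poly_Mapping.lookup p x \<odot> f x \<oplus> Poly_Mapping.lookup q x \<odot> f x)"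
    by (rule M.finsum_cong') (use assms in \<open>auto simp: lookup_add scale_add_left Pi_iff\<close>)
  also have "\<dots> = lin_ext M f p \<oplus> lin_ext M f q"
    using assms by (subst (1 2) lin_ext_superset[of ?F]) (auto simp: Pi_iff intro!: M.finsum_addf)
  finally show ?thesis .
qed

lemma lin_ext_smult:
  assumes "f \<in> Poly_Mapping.keys p \<rightarrow> carrier M"
  shows "lin_ext M f (Poly_Mapping.map ((*) c) p) = c \<odot> lin_ext M f p"
proof -
  have "lin_ext M f (Poly_Mapping.map ((*) c) p)
      = (\<Oplus>x\<in>Poly_Mapping.keys p. c \<odot> (Poly_Mapping.lookup p x \<odot> f x))"
    using assms keys_map_times[of c p]
    by (subst lin_ext_superset[of "Poly_Mapping.keys p"])
       (auto simp: scale_scale Pi_iff intro!: M.finsum_cong')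
  also have "\<dots> = c \<odot> lin_ext M f p"
    unfolding lin_ext_def using assms by (subst finsum_smult_ldistr) auto
  finally show ?thesis .
qed

end

locale finsupp_space =
  fixes M :: "('k::field, 'x \<Rightarrow>\<^sub>0 'k, 'm) module_scheme" (structure) and B :: "'x set"
  assumes finsupp_carrier: "carrier M = {p. Poly_Mapping.keys p \<subseteq> B}"
    and finsupp_zero: "\<zero> = 0"
    and finsupp_add: "p \<oplus> q = p + q"
    and finsupp_smult: "c \<odot> p = Poly_Mapping.map ((*) c) p"

sublocale finsupp_space \<subseteq> linear_space M
proof (rule linear_spaceI)
  show "abelian_group M"
  proof (rule abelian_groupI)
    fix p assume "p \<in> carrier M"
    then show "\<exists>q\<in>carrier M. q \<oplus> p = \<zero>"
      by (intro bexI[of _ "- p"]) (simp_all add: finsupp_carrier finsupp_zero finsupp_add)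
  next
    fix p q assume "p \<in> carrier M" "q \<in> carrier M"
    then show "p \<oplus> q \<in> carrier M"
      using keys_add[of p q] by (auto simp: finsupp_carrier finsupp_add)
  qed (simp_all add: finsupp_carrier finsupp_zero finsupp_add ac_simps)
  fix c p assume "p \<in> carrier M"
  then show "c \<odot> p \<in> carrier M"
    using keys_map_times[of c p] by (auto simp: finsupp_carrier finsupp_smult)
qed (simp_all only: finsupp_add finsupp_smult map_times_poly_mapping)

context finsupp_space
begin

lemma single_closed: "k \<in> B \<Longrightarrow> Poly_Mapping.single k c \<in> carrier M"
  by (simp add: finsupp_carrier)

lemma finsupp_diff:
  assumes "p \<in> carrier M" "q \<in> carrier M"
  shows "p - q = p \<ominus> q"
proof -
  have "\<ominus> q = - q"
    using M.minus_equality[of "- q" q] assms by (simp add: finsupp_carrier finsupp_add finsupp_zero)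
  then show ?thesis by (simp add: M.minus_eq finsupp_add)
qed

lemma carrier_subset_subspace:
  assumes H: "linear_subspace H M" and basis: "\<And>k. k \<in> B \<Longrightarrow> Poly_Mapping.single k 1 \<in> H"
  shows "carrier M \<subseteq> H"
proof
  fix p assume "p \<in> carrier M"
  then have "Poly_Mapping.keys p \<subseteq> B" by (simp add: finsupp_carrier)
  then show "p \<in> H"
  proof (induction p rule: update_induct)
    case const
    show ?case using linear_subspaceD(2)[OF H] by (simp add: finsupp_zero)
  next
    case (update p k c)
    have "Poly_Mapping.update k c p = p \<oplus> c \<odot> Poly_Mapping.single k 1"
      using update.hyps(1)
      by (intro poly_mapping_eqI)
        (auto simp: finsupp_add finsupp_smult map_times_poly_mapping lookup_update lookup_add
          lookup_single in_keys_iff)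
    moreover have "p \<in> H" "k \<in> B"
      using update by (auto simp: keys_update)
    ultimately show ?case
      using linear_subspaceD(3,4)[OF H] basis by simp
  qed
qed

lemma linear_hom_eqI:
  assumes "linear_hom M N f" "linear_hom M N g"
    and "\<And>k. k \<in> B \<Longrightarrow> f (Poly_Mapping.single k 1) = g (Poly_Mapping.single k 1)"
    and "p \<in> carrier M"
  shows "f p = g p"
  using carrier_subset_subspace[OF equalizer_subspace[OF assms(1,2)]] assms(3,4) single_closed
  by blast

lemma lin_ext_linear_hom:
  assumes "linear_space N" "f \<in> B \<rightarrow> carrier N"
  shows "linear_hom M N (lin_ext N f)"
proof -
  interpret N: linear_space N by fact
  have f: "f \<in> Poly_Mapping.keys p \<rightarrow> carrier N" if "p \<in> carrier M" for p
    using that assms(2) by (auto simp: finsupp_carrier)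
  show ?thesis
    by (rule linear_homI) (simp_all add: linear_space_axioms N.linear_space_axioms N.lin_ext_closed
        N.lin_ext_add N.lin_ext_smult finsupp_add finsupp_smult f)
qed

end

lemma finsupp_space_free_module: "finsupp_space (free_module B) B"
  by standard (simp_all add: free_module_def)

lemma (in linear_space) lin_ext_mem_subspace:
  assumes "linear_subspace H M" "f \<in> Poly_Mapping.keys p \<rightarrow> H"
  shows "lin_ext M f p \<in> H"
proof -
  let ?B = "{x. f x \<in> H}"
  interpret F: finsupp_space "free_module ?B" ?B by (rule finsupp_space_free_module)
  interpret ext: linear_hom "free_module ?B" M "lin_ext M f"
    using linear_subspaceD(1)[OF assms(1)] by (intro F.lin_ext_linear_hom linear_space_axioms) auto
  have "carrier (free_module ?B) \<subseteq> {q \<in> carrier (free_module ?B). lin_ext M f q \<in> H}"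
    using linear_subspaceD(1)[OF assms(1)]
    by (intro F.carrier_subset_subspace ext.vimage_subspace assms(1))
      (auto simp: F.single_closed lin_ext_single subset_iff)
  moreover have "p \<in> carrier (free_module ?B)"
    using assms(2) by (auto simp: F.finsupp_carrier)
  ultimately show ?thesis by blast
qed

lemma (in linear_hom) hom_lin_ext:
  assumes "g \<in> Poly_Mapping.keys p \<rightarrow> carrier M"
  shows "f (lin_ext M g p) = lin_ext N (\<lambda>x. f (g x)) p"
proof -
  let ?B = "{x. g x \<in> carrier M}"
  interpret F: finsupp_space "free_module ?B" ?B by (rule finsupp_space_free_module)
  show ?thesis
  proof (rule F.linear_hom_eqI)
    show "linear_hom (free_module ?B) N (\<lambda>p. f (lin_ext M g p))"
      by (rule linear_hom_comp[OF F.lin_ext_linear_hom linear_hom_axioms])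
        (auto simp: M.linear_space_axioms)
    show "linear_hom (free_module ?B) N (lin_ext N (\<lambda>x. f (g x)))"
      by (rule F.lin_ext_linear_hom) (auto simp: N.linear_space_axioms)
    show "p \<in> carrier (free_module ?B)"
      using assms by (auto simp: F.finsupp_carrier)
  qed (simp add: M.lin_ext_single N.lin_ext_single)
qed


section \<open>Tensor products\<close>

definition bilinear_map ::
    "('k::field, 'v, 'm) module_scheme \<Rightarrow> ('k, 'w, 'n) module_scheme
      \<Rightarrow> ('k, 'b, 'l) module_scheme \<Rightarrow> ('v \<Rightarrow> 'w \<Rightarrow> 'b) \<Rightarrow> bool" where
  "bilinear_map V W B f \<longleftrightarrow>
     (\<forall>v\<in>carrier V. linear_hom W B (f v)) \<and> (\<forall>w\<in>carrier W. linear_hom V B (\<lambda>v. f v w))"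

lemma bilinear_mapD:
  assumes "bilinear_map V W B f"
  shows "v \<in> carrier V \<Longrightarrow> linear_hom W B (f v)" "w \<in> carrier W \<Longrightarrow> linear_hom V B (\<lambda>v. f v w)"
  using assms by (auto simp: bilinear_map_def)

locale tensor_prod = V: linear_space V + W: linear_space W
  for V :: "('k::field, 'v, 'm) module_scheme" and W :: "('k, 'w, 'n) module_scheme"
begin

abbreviation FM :: "('k, 'v \<times> 'w \<Rightarrow>\<^sub>0 'k) module" where
  "FM \<equiv> free_module (carrier V \<times> carrier W)"

sublocale F: finsupp_space FM "carrier V \<times> carrier W"
  by (rule finsupp_space_free_module)

lemma single_mem_FM:
  "v \<in> carrier V \<Longrightarrow> w \<in> carrier W \<Longrightarrow> Poly_Mapping.single (v, w) c \<in> carrier FM"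
  by (simp add: F.single_closed)

lemma bilinear_relations_closed: "bilinear_relations V W \<subseteq> carrier FM"
  unfolding bilinear_relations_def Let_def by (auto simp: F.finsupp_diff single_mem_FM)

sublocale T: quotient_space FM "bilinear_span V W"
  rewrites "quot_alg FM (bilinear_span V W) = tensor_product V W"
  unfolding bilinear_span_def tensor_product_def
  by (intro quotient_space.intro quotient_space_axioms.intro F.linear_space_axioms
      F.lin_span_subspace bilinear_relations_closed) (rule refl)

lemma pure_tensor_closed:
  "v \<in> carrier V \<Longrightarrow> w \<in> carrier W \<Longrightarrow> pure_tensor V W v w \<in> carrier (tensor_product V W)"
  unfolding pure_tensor_def by (rule T.coset_mem_quot[OF single_mem_FM])

lemma lin_ext_bilinear_relations:
  assumes f: "bilinear_map V W B f" and r: "r \<in> bilinear_relations V W"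
  shows "lin_ext B (case_prod f) r = \<zero>\<^bsub>B\<^esub>"
proof -
  note right = bilinear_mapD(1)[OF f] and left = bilinear_mapD(2)[OF f]
  interpret B: linear_space B
    using right[OF V.M.zero_closed] by (rule linear_hom.axioms)
  have f_closed: "f v w \<in> carrier B" if "v \<in> carrier V" "w \<in> carrier W" for v w
    using linear_hom.hom_closed[OF right that(2)] that(1) by blast
  interpret ext: linear_hom FM B "lin_ext B (case_prod f)"
    by (rule F.lin_ext_linear_hom) (auto simp: B.linear_space_axioms f_closed)
  show ?thesis
    using r unfolding bilinear_relations_def Let_def
    by (auto simp: F.finsupp_diff single_mem_FM B.lin_ext_single f_closed B.diff_diff_eq
        linear_hom.hom_add[OF left] linear_hom.hom_add[OF right]
        linear_hom.hom_smult[OF left] linear_hom.hom_smult[OF right])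
qed

lemma tensor_product_lift:
  assumes "bilinear_map V W B f"
  obtains g where "linear_hom (tensor_product V W) B g"
    "\<And>p. p \<in> carrier FM \<Longrightarrow> g (bilinear_span V W +>\<^bsub>FM\<^esub> p) = lin_ext B (case_prod f) p"
proof -
  note right = bilinear_mapD(1)[OF assms]
  interpret ext: linear_hom FM B "lin_ext B (case_prod f)"
    using linear_hom.axioms(2)[OF right[OF V.M.zero_closed]] linear_hom.hom_closed[OF right]
    by (intro F.lin_ext_linear_hom) auto
  have "lin_ext B (case_prod f) p = \<zero>\<^bsub>B\<^esub>" if "p \<in> bilinear_span V W" for p
    using ext.lin_span_zero[OF bilinear_relations_closed lin_ext_bilinear_relations[OF assms]] that
    unfolding bilinear_span_def by blast
  from T.quot_lift[OF ext.linear_hom_axioms this] show thesis using that by blast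
qed

end


section \<open>Free algebras and tensor algebras\<close>

lemma fmonoid_simps [simp]:
  "letters (u + v) = letters u @ letters v" "letters 0 = []"
  by (simp_all add: plus_fmonoid_def zero_fmonoid_def)

lemma Word_Nil: "Word [] = 0"
  by (simp add: zero_fmonoid_def)

lemma mult_single_Word:
  "Poly_Mapping.single (Word u) c * Poly_Mapping.single (Word v) d
    = (Poly_Mapping.single (Word (u @ v)) (c * d) :: 'v fmonoid \<Rightarrow>\<^sub>0 'k::field)"
  by (simp add: mult_single plus_fmonoid_def)

abbreviation words :: "('k::field, 'v, 'm) module_scheme \<Rightarrow> 'v fmonoid set" where
  "words V \<equiv> {w. set (letters w) \<subseteq> carrier V}"

lemma finsupp_space_free_algebra: "finsupp_space (free_algebra V) (words V)"
  by standard (auto simp: free_algebra_def)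

lemma free_algebra_mult: "p \<otimes>\<^bsub>free_algebra V\<^esub> q = p * q"
  and free_algebra_one: "\<one>\<^bsub>free_algebra V\<^esub> = 1"
  by (simp_all add: free_algebra_def)

lemma mult_single_zero_commute:
  fixes p :: "'x::monoid_add \<Rightarrow>\<^sub>0 'k::field"
  shows "p * Poly_Mapping.single 0 c = Poly_Mapping.single 0 c * p"
proof -
  interpret F: finsupp_space "free_module (UNIV :: 'x set) :: ('k, 'x \<Rightarrow>\<^sub>0 'k) module" UNIV
    by (rule finsupp_space_free_module)
  let ?H = "{p :: 'x \<Rightarrow>\<^sub>0 'k. p * Poly_Mapping.single 0 c = Poly_Mapping.single 0 c * p}"
  have "linear_subspace ?H (free_module UNIV)"
  proof (rule F.linear_subspaceI)
    show "d \<odot>\<^bsub>free_module UNIV\<^esub> p \<in> ?H" if "p \<in> ?H" for d p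
    proof -
      have "Poly_Mapping.single 0 d * p * Poly_Mapping.single 0 c
          = Poly_Mapping.single 0 d * (Poly_Mapping.single 0 c * p)"
        using that by (simp add: mult.assoc)
      also have "\<dots> = Poly_Mapping.single 0 c * (Poly_Mapping.single 0 d * p)"
        by (simp add: mult_single mult.commute flip: mult.assoc)
      finally show ?thesis by (simp add: F.finsupp_smult mult_map_scale_conv_mult)
    qed
  qed (simp_all add: F.finsupp_carrier F.finsupp_zero F.finsupp_add distrib_left distrib_right)
  then have "carrier (free_module UNIV) \<subseteq> ?H"
    by (rule F.carrier_subset_subspace) (simp add: mult_single)
  then show ?thesis by (auto simp: F.finsupp_carrier)
qed

lemma free_algebra_assoc_algebra:
  fixes V :: "('k::field, 'v, 'm) module_scheme"
  shows "assoc_algebra (free_algebra V)"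
proof -
  interpret F: finsupp_space "free_algebra V" "words V"
    by (rule finsupp_space_free_algebra)
  have closed: "p * q \<in> carrier (free_algebra V)"
    if "p \<in> carrier (free_algebra V)" "q \<in> carrier (free_algebra V)" for p q
    using that keys_mult[of p q] by (fastforce simp: F.finsupp_carrier)
  have smult_left: "Poly_Mapping.map ((*) c) p * q = Poly_Mapping.map ((*) c) (p * q)"
    and smult_right: "p * Poly_Mapping.map ((*) c) q = Poly_Mapping.map ((*) c) (p * q)"
    for c :: 'k and p q :: "'v fmonoid \<Rightarrow>\<^sub>0 'k"
    by (simp_all add: mult_map_scale_conv_mult mult_single_zero_commute flip: mult.assoc)
  show ?thesis
  proof (intro assoc_algebra.intro assoc_algebra_axioms.intro F.linear_space_axioms ringI
      F.M.abelian_group_axioms monoidI)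
    show "\<one>\<^bsub>free_algebra V\<^esub> \<in> carrier (free_algebra V)"
      by (simp add: F.finsupp_carrier free_algebra_one)
  qed (simp_all add: free_algebra_mult free_algebra_one F.finsupp_add F.finsupp_smult closed
      mult.assoc distrib_left distrib_right smult_left smult_right)
qed

definition word_prod :: "('k, 'b, 'n) module_scheme \<Rightarrow> ('v \<Rightarrow> 'b) \<Rightarrow> 'v fmonoid \<Rightarrow> 'b" where
  "word_prod B f w = foldr (\<lambda>x r. f x \<otimes>\<^bsub>B\<^esub> r) (letters w) \<one>\<^bsub>B\<^esub>"

context assoc_algebra
begin

lemma word_prod_closed: "f ` set (letters w) \<subseteq> carrier A \<Longrightarrow> word_prod A f w \<in> carrier A"
proof (induction w)
  case (Word u)
  then show ?case by (induction u) (simp_all add: word_prod_def)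
qed

lemma word_prod_add:
  assumes v: "f ` set (letters v) \<subseteq> carrier A"
  shows "f ` set (letters u) \<subseteq> carrier A \<Longrightarrow>
    word_prod A f (u + v) = word_prod A f u \<otimes> word_prod A f v"
proof (induction u)
  case (Word u)
  then show ?case
  proof (induction u)
    case Nil
    show ?case using word_prod_closed[OF v] by (simp add: word_prod_def)
  next
    case (Cons x u)
    have "word_prod A f (Word (x # u) + v) = f x \<otimes> word_prod A f (Word u + v)"
      by (simp add: word_prod_def)
    also have "\<dots> = (f x \<otimes> word_prod A f (Word u)) \<otimes> word_prod A f v"
      using Cons word_prod_closed[OF v] word_prod_closed[of f "Word u"] by (simp add: m_assoc)
    also have "f x \<otimes> word_prod A f (Word u) = word_prod A f (Word (x # u))"
      by (simp add: word_prod_def)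
    finally show ?case .
  qed
qed

lemma linear_hom_free_algebra_mult:
  assumes h: "linear_hom (free_algebra V) A h"
    and mult_words: "\<And>u v. u \<in> words V \<Longrightarrow> v \<in> words V \<Longrightarrow>
      h (Poly_Mapping.single u 1 \<otimes>\<^bsub>free_algebra V\<^esub> Poly_Mapping.single v 1)
        = h (Poly_Mapping.single u 1) \<otimes> h (Poly_Mapping.single v 1)"
    and p: "p \<in> carrier (free_algebra V)" and q: "q \<in> carrier (free_algebra V)"
  shows "h (p \<otimes>\<^bsub>free_algebra V\<^esub> q) = h p \<otimes> h q"
proof -
  let ?F = "free_algebra V"
  interpret F: finsupp_space ?F "words V" by (rule finsupp_space_free_algebra)
  interpret F: assoc_algebra ?F by (rule free_algebra_assoc_algebra)
  interpret h: linear_hom ?F A h by (rule h)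
  have mult_word: "h (Poly_Mapping.single u 1 \<otimes>\<^bsub>?F\<^esub> q) = h (Poly_Mapping.single u 1) \<otimes> h q"
    if u: "u \<in> words V" for u
  proof (rule F.linear_hom_eqI[of _ _ "\<lambda>q. h (Poly_Mapping.single u 1) \<otimes> h q"])
    have word_closed: "Poly_Mapping.single u 1 \<in> carrier ?F" using u by (rule F.single_closed)
    show "linear_hom ?F A (\<lambda>q. h (Poly_Mapping.single u 1 \<otimes>\<^bsub>?F\<^esub> q))"
      by (rule linear_hom_comp[OF F.mult_left_linear[OF word_closed] h])
    show "linear_hom ?F A (\<lambda>q. h (Poly_Mapping.single u 1) \<otimes> h q)"
      by (rule linear_hom_comp[OF h mult_left_linear[OF h.hom_closed[OF word_closed]]])
  qed (use mult_words[OF u] q in auto)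
  show ?thesis
  proof (rule F.linear_hom_eqI[of _ _ "\<lambda>p. h p \<otimes> h q"])
    show "linear_hom ?F A (\<lambda>p. h (p \<otimes>\<^bsub>?F\<^esub> q))"
      by (rule linear_hom_comp[OF F.mult_right_linear[OF q] h])
    show "linear_hom ?F A (\<lambda>p. h p \<otimes> h q)"
      by (rule linear_hom_comp[OF h mult_right_linear[OF h.hom_closed[OF q]]])
  qed (use mult_word p in auto)
qed

lemma free_algebra_hom:
  assumes f: "f \<in> carrier V \<rightarrow> carrier A"
  shows "algebra_hom (free_algebra V) A (lin_ext A (word_prod A f))"
proof -
  let ?F = "free_algebra V" and ?h = "lin_ext A (word_prod A f)"
  interpret F: finsupp_space ?F "words V" by (rule finsupp_space_free_algebra)
  interpret F: assoc_algebra ?F by (rule free_algebra_assoc_algebra)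
  have prod_closed: "word_prod A f w \<in> carrier A" if "w \<in> words V" for w
    using that f by (intro word_prod_closed) auto
  have linear: "linear_hom ?F A ?h"
    by (rule F.lin_ext_linear_hom) (simp_all add: linear_space_axioms prod_closed)
  have single: "?h (Poly_Mapping.single w c) = c \<odot> word_prod A f w" if "w \<in> words V" for w c
    using that by (simp add: lin_ext_single prod_closed)
  have mult_words: "?h (Poly_Mapping.single u 1 \<otimes>\<^bsub>?F\<^esub> Poly_Mapping.single v 1)
      = ?h (Poly_Mapping.single u 1) \<otimes> ?h (Poly_Mapping.single v 1)"
    if u: "u \<in> words V" and v: "v \<in> words V" for u v
  proof -
    have "word_prod A f (u + v) = word_prod A f u \<otimes> word_prod A f v"
      using u v f by (intro word_prod_add) auto
    then show ?thesis using u v by (simp add: free_algebra_mult mult_single single prod_closed)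
  qed
  have "?h \<one>\<^bsub>?F\<^esub> = \<one>"
    using single[of 0 1] by (simp add: free_algebra_one word_prod_def)
  then show ?thesis
    by (intro algebra_hom.intro algebra_hom_axioms.intro F.assoc_algebra_axioms
        assoc_algebra_axioms linear linear_hom_free_algebra_mult[OF linear mult_words])
qed

lemma lin_ext_word_prod_letter:
  assumes "f x \<in> carrier A"
  shows "lin_ext A (word_prod A f) (Poly_Mapping.single (Word [x]) c) = c \<odot> f x"
  using assms by (subst lin_ext_single) (simp_all add: word_prod_def)

end

definition letter_relations :: "('k::field, 'v, 'm) module_scheme \<Rightarrow> ('v fmonoid \<Rightarrow>\<^sub>0 'k) set" where
  "letter_relations V =
     (let e = (\<lambda>x c. Poly_Mapping.single (Word [x]) c) in
      {e (x \<oplus>\<^bsub>V\<^esub> y) 1 - e x 1 - e y 1 | x y. x \<in> carrier V \<and> y \<in> carrier V} \<union>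
      {e (c \<odot>\<^bsub>V\<^esub> x) 1 - e x c | c x. x \<in> carrier V})"

lemma letter_relations_cases:
  assumes "r \<in> letter_relations V"
  obtains (add) x y where "x \<in> carrier V" "y \<in> carrier V"
      "r = Poly_Mapping.single (Word [x \<oplus>\<^bsub>V\<^esub> y]) 1 - Poly_Mapping.single (Word [x]) 1
        - Poly_Mapping.single (Word [y]) 1"
    | (smult) c x where "x \<in> carrier V"
      "r = Poly_Mapping.single (Word [c \<odot>\<^bsub>V\<^esub> x]) 1 - Poly_Mapping.single (Word [x]) c"
  using assms unfolding letter_relations_def Let_def by blast

lemma multilinear_relationsI:
  assumes "r \<in> letter_relations V" "u \<in> words V" "v \<in> words V"
  shows "Poly_Mapping.single u 1 * r * Poly_Mapping.single v 1 \<in> multilinear_relations V"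
proof -
  let ?e = "\<lambda>u. Poly_Mapping.single (Word u)"
  obtain u' v' where uv: "u = Word u'" "v = Word v'" by (cases u; cases v)
  then have letters: "set u' \<subseteq> carrier V" "set v' \<subseteq> carrier V" using assms(2,3) by auto
  from assms(1) show ?thesis
  proof (cases rule: letter_relations_cases)
    case (add x y)
    have "Poly_Mapping.single u 1 * r * Poly_Mapping.single v 1
        = ?e (u' @ [x \<oplus>\<^bsub>V\<^esub> y] @ v') 1 - ?e (u' @ [x] @ v') 1 - ?e (u' @ [y] @ v') 1"
      unfolding add(3) uv by (simp add: mult_single_Word algebra_simps)
    then show ?thesis
      using add(1,2) letters unfolding multilinear_relations_def Let_def by blast
  next
    case (smult c x)
    have "Poly_Mapping.single u 1 * r * Poly_Mapping.single v 1
        = ?e (u' @ [c \<odot>\<^bsub>V\<^esub> x] @ v') 1 - ?e (u' @ [x] @ v') c"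
      unfolding smult(2) uv by (simp add: mult_single_Word algebra_simps)
    then show ?thesis
      using smult(1) letters unfolding multilinear_relations_def Let_def by blast
  qed
qed

lemma multilinear_relationsE:
  assumes "r \<in> multilinear_relations V"
  obtains u r' v where "u \<in> words V" "r' \<in> letter_relations V" "v \<in> words V"
    "r = Poly_Mapping.single u 1 * r' * Poly_Mapping.single v 1"
proof -
  let ?e = "\<lambda>u. Poly_Mapping.single (Word u)"
  from assms consider
    (add) u x y v where "x \<in> carrier V" "y \<in> carrier V" "Word u \<in> words V" "Word v \<in> words V"
      "r = ?e (u @ [x \<oplus>\<^bsub>V\<^esub> y] @ v) 1 - ?e (u @ [x] @ v) 1 - ?e (u @ [y] @ v) 1"
    | (smult) c u x v where "x \<in> carrier V" "Word u \<in> words V" "Word v \<in> words V"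
      "r = ?e (u @ [c \<odot>\<^bsub>V\<^esub> x] @ v) 1 - ?e (u @ [x] @ v) c"
    unfolding multilinear_relations_def Let_def by auto
  then show thesis
  proof cases
    case add
    then have "r = ?e u 1 * (?e [x \<oplus>\<^bsub>V\<^esub> y] 1 - ?e [x] 1 - ?e [y] 1) * ?e v 1"
      by (simp add: mult_single_Word algebra_simps)
    moreover have "?e [x \<oplus>\<^bsub>V\<^esub> y] 1 - ?e [x] 1 - ?e [y] 1 \<in> letter_relations V"
      using add(1,2) unfolding letter_relations_def Let_def by blast
    ultimately show thesis using add(3,4) by (intro that)
  next
    case smult
    then have "r = ?e u 1 * (?e [c \<odot>\<^bsub>V\<^esub> x] 1 - ?e [x] c) * ?e v 1"
      by (simp add: mult_single_Word algebra_simps)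
    moreover have "?e [c \<odot>\<^bsub>V\<^esub> x] 1 - ?e [x] c \<in> letter_relations V"
      using smult(1) unfolding letter_relations_def Let_def by blast
    ultimately show thesis using smult(2,3) by (intro that)
  qed
qed

locale tensor_alg = linear_space V
  for V :: "('k::field, 'v, 'm) module_scheme" (structure)
begin

abbreviation FA :: "('k, 'v fmonoid \<Rightarrow>\<^sub>0 'k) module" where
  "FA \<equiv> free_algebra V"

abbreviation TA :: "('k, ('v fmonoid \<Rightarrow>\<^sub>0 'k) set) module" where
  "TA \<equiv> tensor_algebra V"

abbreviation tensor_class :: "('v fmonoid \<Rightarrow>\<^sub>0 'k) \<Rightarrow> ('v fmonoid \<Rightarrow>\<^sub>0 'k) set" where
  "tensor_class p \<equiv> multilinear_span V +>\<^bsub>FA\<^esub> p"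

sublocale F: finsupp_space FA "words V"
  by (rule finsupp_space_free_algebra)

sublocale F: assoc_algebra FA
  by (rule free_algebra_assoc_algebra)

lemma letter_closed: "x \<in> carrier V \<Longrightarrow> Poly_Mapping.single (Word [x]) c \<in> carrier FA"
  by (simp add: F.single_closed)

lemma letter_relations_closed: "letter_relations V \<subseteq> carrier FA"
  unfolding letter_relations_def Let_def by (auto simp: letter_closed F.finsupp_diff)

lemma multilinear_relations_closed: "multilinear_relations V \<subseteq> carrier FA"
proof
  fix r assume "r \<in> multilinear_relations V"
  then obtain u r' v where "u \<in> words V" "r' \<in> letter_relations V" "v \<in> words V"
    "r = Poly_Mapping.single u 1 \<otimes>\<^bsub>FA\<^esub> r' \<otimes>\<^bsub>FA\<^esub> Poly_Mapping.single v 1"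
    unfolding free_algebra_mult by (rule multilinear_relationsE)
  then show "r \<in> carrier FA" using letter_relations_closed by (auto simp: F.single_closed)
qed

lemma multilinear_relations_subset_span: "multilinear_relations V \<subseteq> multilinear_span V"
  unfolding multilinear_span_def by (rule lin_span_superset)

lemma letter_relations_subset_span: "letter_relations V \<subseteq> multilinear_span V"
proof
  fix r assume "r \<in> letter_relations V"
  then have "r \<in> multilinear_relations V" using multilinear_relationsI[of r V 0 0] by simp
  then show "r \<in> multilinear_span V" using multilinear_relations_subset_span by blast
qed

lemma multilinear_span_subspace: "linear_subspace (multilinear_span V) FA"
  unfolding multilinear_span_def by (rule F.lin_span_subspace[OF multilinear_relations_closed])

lemma multilinear_relations_mult_word:
  assumes "r \<in> multilinear_relations V" "w \<in> words V"
  shows "Poly_Mapping.single w 1 * r \<in> multilinear_relations V"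
    and "r * Poly_Mapping.single w 1 \<in> multilinear_relations V"
proof -
  obtain u r' v where r': "u \<in> words V" "r' \<in> letter_relations V" "v \<in> words V"
    and r: "r = Poly_Mapping.single u 1 * r' * Poly_Mapping.single v 1"
    using assms(1) by (rule multilinear_relationsE)
  have "Poly_Mapping.single w 1 * r
      = Poly_Mapping.single (w + u) 1 * r' * Poly_Mapping.single v 1"
    by (simp add: r mult_single flip: mult.assoc)
  then show "Poly_Mapping.single w 1 * r \<in> multilinear_relations V"
    using r' assms(2) by (simp add: multilinear_relationsI)
  have "r * Poly_Mapping.single w 1
      = Poly_Mapping.single u 1 * r' * Poly_Mapping.single (v + w) 1"
    by (simp add: r mult_single mult.assoc)
  then show "r * Poly_Mapping.single w 1 \<in> multilinear_relations V"
    using r' assms(2) by (simp add: multilinear_relationsI)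
qed

lemma multilinear_span_stable:
  assumes f: "linear_hom FA FA f"
    and relations: "\<And>r. r \<in> multilinear_relations V \<Longrightarrow> f r \<in> multilinear_relations V"
    and "p \<in> multilinear_span V"
  shows "f p \<in> multilinear_span V"
proof -
  have "f ` multilinear_relations V \<subseteq> multilinear_span V"
    using relations multilinear_relations_subset_span by blast
  from linear_hom.image_lin_span_subset[OF f multilinear_span_subspace
      multilinear_relations_closed this, folded multilinear_span_def]
  show ?thesis using assms(3) by blast
qed

lemma multilinear_span_mult_word:
  assumes "p \<in> multilinear_span V" "w \<in> words V"
  shows "Poly_Mapping.single w 1 \<otimes>\<^bsub>FA\<^esub> p \<in> multilinear_span V"
    and "p \<otimes>\<^bsub>FA\<^esub> Poly_Mapping.single w 1 \<in> multilinear_span V"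
proof -
  note w_closed = F.single_closed[OF assms(2), of 1]
  show "Poly_Mapping.single w 1 \<otimes>\<^bsub>FA\<^esub> p \<in> multilinear_span V"
    by (rule multilinear_span_stable[OF F.mult_left_linear[OF w_closed] _ assms(1)])
      (use assms(2) in \<open>simp add: free_algebra_mult multilinear_relations_mult_word\<close>)
  show "p \<otimes>\<^bsub>FA\<^esub> Poly_Mapping.single w 1 \<in> multilinear_span V"
    by (rule multilinear_span_stable[OF F.mult_right_linear[OF w_closed] _ assms(1)])
      (use assms(2) in \<open>simp add: free_algebra_mult multilinear_relations_mult_word\<close>)
qed

lemma multilinear_span_ideal: "ideal (multilinear_span V) FA"
proof (rule idealI)
  show "ring FA" by (rule F.ring_axioms)
  show "subgroup (multilinear_span V) (add_monoid FA)"
    by (rule submodule.axioms(1)[OF multilinear_span_subspace])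
next
  fix p q assume p: "p \<in> multilinear_span V" and q: "q \<in> carrier FA"
  note p_closed = subsetD[OF linear_subspaceD(1)[OF multilinear_span_subspace] p]
  let ?left = "{q \<in> carrier FA. q \<otimes>\<^bsub>FA\<^esub> p \<in> multilinear_span V}"
  let ?right = "{q \<in> carrier FA. p \<otimes>\<^bsub>FA\<^esub> q \<in> multilinear_span V}"
  have "linear_subspace ?left FA"
    by (rule linear_hom.vimage_subspace[OF F.mult_right_linear[OF p_closed]
        multilinear_span_subspace])
  then have "carrier FA \<subseteq> ?left"
    by (rule F.carrier_subset_subspace) (simp add: multilinear_span_mult_word p F.single_closed)
  then show "q \<otimes>\<^bsub>FA\<^esub> p \<in> multilinear_span V" using q by blast
  have "linear_subspace ?right FA"
    by (rule linear_hom.vimage_subspace[OF F.mult_left_linear[OF p_closed]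
        multilinear_span_subspace])
  then have "carrier FA \<subseteq> ?right"
    by (rule F.carrier_subset_subspace) (simp add: multilinear_span_mult_word p F.single_closed)
  then show "p \<otimes>\<^bsub>FA\<^esub> q \<in> multilinear_span V" using q by blast
qed

sublocale T: quotient_algebra FA "multilinear_span V"
  rewrites "quot_alg FA (multilinear_span V) = tensor_algebra V"
  by (intro quotient_algebra.intro F.assoc_algebra_axioms multilinear_span_ideal)
    (simp add: tensor_algebra_def)

sublocale cls: algebra_hom FA TA tensor_class
  by (rule T.coset_algebra_hom)

lemma tensor_emb_linear: "linear_hom V TA (tensor_emb V)"
proof (rule linear_homI[OF linear_space_axioms cls.B.linear_space_axioms])
  note relation_class = T.coset_eq_zero[OF subsetD[OF letter_relations_subset_span]]
  fix x c assume x: "x \<in> carrier V"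
  then show "tensor_emb V x \<in> carrier TA" by (simp add: tensor_emb_def letter_closed)
  have "Poly_Mapping.single (Word [c \<odot> x]) 1 - Poly_Mapping.single (Word [x]) c
      \<in> letter_relations V"
    using x unfolding letter_relations_def Let_def by blast
  from relation_class[OF this]
  have "tensor_emb V (c \<odot> x) = tensor_class (c \<odot>\<^bsub>FA\<^esub> Poly_Mapping.single (Word [x]) 1)"
    using x by (simp add: tensor_emb_def F.finsupp_diff letter_closed F.finsupp_smult
        map_times_poly_mapping)
  then show "tensor_emb V (c \<odot> x) = c \<odot>\<^bsub>TA\<^esub> tensor_emb V x"
    using x by (simp add: tensor_emb_def letter_closed)
  fix y assume y: "y \<in> carrier V"
  have "Poly_Mapping.single (Word [x \<oplus> y]) 1 - Poly_Mapping.single (Word [x]) 1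
      - Poly_Mapping.single (Word [y]) 1 \<in> letter_relations V"
    using x y unfolding letter_relations_def Let_def by blast
  from relation_class[OF this]
  show "tensor_emb V (x \<oplus> y) = tensor_emb V x \<oplus>\<^bsub>TA\<^esub> tensor_emb V y"
    using x y
    by (simp add: tensor_emb_def F.finsupp_diff letter_closed cls.B.diff_diff_eq)
qed

lemma tensor_lift:
  assumes "assoc_algebra B" "linear_hom V B f"
  obtains g where "algebra_hom TA B g" "\<And>x. x \<in> carrier V \<Longrightarrow> g (tensor_emb V x) = f x"
proof -
  interpret B: assoc_algebra B by fact
  interpret f: linear_hom V B f by fact
  let ?h = "lin_ext B (word_prod B f)"
  interpret h: algebra_hom FA B ?h by (rule B.free_algebra_hom) simp
  have letter: "?h (Poly_Mapping.single (Word [x]) c) = c \<odot>\<^bsub>B\<^esub> f x" if "x \<in> carrier V" for x c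
    using that by (simp add: B.lin_ext_word_prod_letter)
  have letter_relation: "?h r = \<zero>\<^bsub>B\<^esub>" if "r \<in> letter_relations V" for r
    using that
    by (cases rule: letter_relations_cases)
      (simp_all add: letter letter_closed F.finsupp_diff B.diff_diff_eq)
  have "?h r = \<zero>\<^bsub>B\<^esub>" if r: "r \<in> multilinear_relations V" for r
  proof -
    obtain u r' v where "u \<in> words V" "r' \<in> letter_relations V" "v \<in> words V"
      "r = Poly_Mapping.single u 1 \<otimes>\<^bsub>FA\<^esub> r' \<otimes>\<^bsub>FA\<^esub> Poly_Mapping.single v 1"
      using r unfolding free_algebra_mult by (rule multilinear_relationsE)
    then show ?thesis
      using letter_relations_closed by (auto simp: F.single_closed letter_relation subset_iff)
  qed
  then have "?h p = \<zero>\<^bsub>B\<^esub>" if "p \<in> multilinear_span V" for p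
    using h.lin_span_zero[OF multilinear_relations_closed] that
    unfolding multilinear_span_def by blast
  then obtain g where g: "algebra_hom TA B g" "\<And>p. p \<in> carrier FA \<Longrightarrow> g (tensor_class p) = ?h p"
    using T.quot_algebra_lift[OF h.algebra_hom_axioms] by blast
  then have "g (tensor_emb V x) = f x" if "x \<in> carrier V" for x
    using that by (simp add: tensor_emb_def letter_closed letter)
  with g(1) show thesis by (rule that)
qed

lemma tensor_algebra_generated:
  assumes H: "assoc_subalgebra H TA" and emb: "tensor_emb V ` carrier V \<subseteq> H"
  shows "carrier TA \<subseteq> H"
proof -
  let ?K = "{p \<in> carrier FA. tensor_class p \<in> H}"
  have K: "assoc_subalgebra ?K FA" by (rule cls.vimage_subalgebra[OF H])
  note K_submonoid = assoc_subalgebra_submonoid[OF K]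
  have letter: "Poly_Mapping.single (Word [x]) 1 \<in> ?K" if "x \<in> carrier V" for x
    using that emb by (auto simp: tensor_emb_def letter_closed)
  have word: "Poly_Mapping.single (Word u) 1 \<in> ?K" if "set u \<subseteq> carrier V" for u
    using that
  proof (induction u)
    case Nil
    show ?case
      using submonoid.one_closed[OF K_submonoid] unfolding free_algebra_one Word_Nil single_one .
  next
    case (Cons x u)
    then have "Poly_Mapping.single (Word [x]) 1 \<otimes>\<^bsub>FA\<^esub> Poly_Mapping.single (Word u) 1 \<in> ?K"
      by (intro submonoid.m_closed[OF K_submonoid] letter) simp_all
    then show ?case by (simp add: free_algebra_mult mult_single_Word)
  qed
  have "carrier FA \<subseteq> ?K"
  proof (rule F.carrier_subset_subspace[OF assoc_subalgebra_subspace[OF K]])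
    fix w assume "w \<in> words V"
    then show "Poly_Mapping.single w 1 \<in> ?K" using word[of "letters w"] by simp
  qed
  then show ?thesis by (auto simp: T.quot_carrier)
qed

end


section \<open>Algebras presented by relations\<close>

definition presented_algebra ::
    "('k::field, 'v, 'm) module_scheme \<Rightarrow> ('v fmonoid \<Rightarrow>\<^sub>0 'k) set set
      \<Rightarrow> ('k, ('v fmonoid \<Rightarrow>\<^sub>0 'k) set set) module" where
  "presented_algebra V R = quot_alg (tensor_algebra V) (genideal (tensor_algebra V) R)"

definition presented_emb ::
    "('k::field, 'v, 'm) module_scheme \<Rightarrow> ('v fmonoid \<Rightarrow>\<^sub>0 'k) set set
      \<Rightarrow> 'v \<Rightarrow> ('v fmonoid \<Rightarrow>\<^sub>0 'k) set set" where
  "presented_emb V R x = genideal (tensor_algebra V) R +>\<^bsub>tensor_algebra V\<^esub> tensor_emb V x"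

locale presented_alg = tensor_alg V
  for V :: "('k::field, 'v, 'm) module_scheme" (structure) +
  fixes R
  assumes relations_closed: "R \<subseteq> carrier (tensor_algebra V)"
begin

abbreviation PA :: "('k, ('v fmonoid \<Rightarrow>\<^sub>0 'k) set set) module" where
  "PA \<equiv> presented_algebra V R"

abbreviation presented_class :: "('v fmonoid \<Rightarrow>\<^sub>0 'k) set \<Rightarrow> ('v fmonoid \<Rightarrow>\<^sub>0 'k) set set" where
  "presented_class t \<equiv> genideal TA R +>\<^bsub>TA\<^esub> t"

sublocale P: quotient_algebra TA "genideal TA R"
  rewrites "quot_alg TA (genideal TA R) = PA"
  by (intro quotient_algebra.intro cls.B.assoc_algebra_axioms cls.B.genideal_ideal relations_closed)
    (simp add: presented_algebra_def)

sublocale pcls: algebra_hom TA PA presented_class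
  by (rule P.coset_algebra_hom)

lemma presented_emb_linear: "linear_hom V PA (presented_emb V R)"
  unfolding presented_emb_def
  by (rule linear_hom_comp[OF tensor_emb_linear pcls.linear_hom_axioms])

lemma presented_class_eq:
  assumes "s \<ominus>\<^bsub>TA\<^esub> t \<in> R" "s \<in> carrier TA" "t \<in> carrier TA"
  shows "presented_class s = presented_class t"
  using assms cls.B.genideal_self[OF relations_closed] by (subst P.coset_eq_iff) auto

lemma presented_lift:
  assumes B: "assoc_algebra B" and f: "linear_hom V B f"
    and relations: "\<And>h r. \<lbrakk>algebra_hom TA B h; \<And>x. x \<in> carrier V \<Longrightarrow> h (tensor_emb V x) = f x; r \<in> R\<rbrakk>
      \<Longrightarrow> h r = \<zero>\<^bsub>B\<^esub>"
  obtains g where "algebra_hom PA B g" "\<And>x. x \<in> carrier V \<Longrightarrow> g (presented_emb V R x) = f x"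
proof -
  obtain h where h: "algebra_hom TA B h" "\<And>x. x \<in> carrier V \<Longrightarrow> h (tensor_emb V x) = f x"
    using tensor_lift[OF B f] by blast
  have "h t = \<zero>\<^bsub>B\<^esub>" if "t \<in> genideal TA R" for t
    using algebra_hom.genideal_zero[OF h(1) relations_closed relations[OF h] that] .
  then obtain g where g: "algebra_hom PA B g" "\<And>t. t \<in> carrier TA \<Longrightarrow> g (presented_class t) = h t"
    using P.quot_algebra_lift[OF h(1)] by blast
  then have "g (presented_emb V R x) = f x" if "x \<in> carrier V" for x
    using that h(2) linear_hom.hom_closed[OF tensor_emb_linear] by (simp add: presented_emb_def)
  with g(1) show thesis by (rule that)
qed

lemma presented_algebra_generated:
  assumes "assoc_subalgebra H PA" "presented_emb V R ` carrier V \<subseteq> H"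
  shows "carrier PA \<subseteq> H"
proof -
  have "carrier TA \<subseteq> {t \<in> carrier TA. presented_class t \<in> H}"
    using assms(2) linear_hom.hom_closed[OF tensor_emb_linear]
    by (intro tensor_algebra_generated pcls.vimage_subalgebra assms(1))
      (auto simp: presented_emb_def)
  then show ?thesis by (auto simp: P.quot_carrier)
qed

end


section \<open>Half commutators\<close>

context assoc_algebra
begin

definition half_commutator :: "'a \<Rightarrow> 'a \<Rightarrow> 'a" where
  "half_commutator x y = (1/2) \<odot> (x \<otimes> y \<ominus> y \<otimes> x)"

definition half_anticommutator :: "'a \<Rightarrow> 'a \<Rightarrow> 'a" where
  "half_anticommutator x y = (1/2) \<odot> (x \<otimes> y \<oplus> y \<otimes> x)"

definition half_supercommutator :: "bit \<Rightarrow> bit \<Rightarrow> 'a \<Rightarrow> 'a \<Rightarrow> 'a" where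
  "half_supercommutator i k x y = (1/2) \<odot> (x \<otimes> y \<ominus> koszul_sign i k \<odot> (y \<otimes> x))"

lemma half_commutator_closed [simp]:
  "x \<in> carrier A \<Longrightarrow> y \<in> carrier A \<Longrightarrow> half_commutator x y \<in> carrier A"
  by (simp add: half_commutator_def)

lemma half_anticommutator_closed [simp]:
  "x \<in> carrier A \<Longrightarrow> y \<in> carrier A \<Longrightarrow> half_anticommutator x y \<in> carrier A"
  by (simp add: half_anticommutator_def)

lemma half_supercommutator_closed [simp]:
  "x \<in> carrier A \<Longrightarrow> y \<in> carrier A \<Longrightarrow> half_supercommutator i k x y \<in> carrier A"
  by (simp add: half_supercommutator_def)

lemma half_anticommutator_commute:
  "x \<in> carrier A \<Longrightarrow> y \<in> carrier A \<Longrightarrow> half_anticommutator x y = half_anticommutator y x"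
  by (simp add: half_anticommutator_def M.a_comm)

lemma half_commutator_antisym:
  "x \<in> carrier A \<Longrightarrow> y \<in> carrier A \<Longrightarrow> half_commutator x y = \<ominus> half_commutator y x"
  by (simp add: half_commutator_def M.minus_eq M.minus_add M.a_comm flip: smult_r_minus)

lemma half_commutator_minus_left:
  "x \<in> carrier A \<Longrightarrow> y \<in> carrier A \<Longrightarrow> half_commutator (\<ominus> x) y = half_commutator y x"
  by (simp add: half_commutator_def l_minus r_minus M.minus_eq M.a_comm)

lemma half_supercommutator_simps:
  assumes "x \<in> carrier A" "y \<in> carrier A"
  shows "half_supercommutator 1 1 x y = half_anticommutator x y"
    and "half_supercommutator 0 i x y = half_commutator x y"
    and "half_supercommutator i 0 x y = half_commutator x y"
  using assms by (simp_all add: half_supercommutator_def half_anticommutator_def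
      half_commutator_def koszul_sign_def scale_minus_one M.minus_eq)

lemma half_commutator_zero [simp]:
  "x \<in> carrier A \<Longrightarrow> half_commutator \<zero> x = \<zero>" "x \<in> carrier A \<Longrightarrow> half_commutator x \<zero> = \<zero>"
  by (simp_all add: half_commutator_def M.minus_eq)

lemma half_anticommutator_zero [simp]:
  "x \<in> carrier A \<Longrightarrow> half_anticommutator \<zero> x = \<zero>"
  "x \<in> carrier A \<Longrightarrow> half_anticommutator x \<zero> = \<zero>"
  by (simp_all add: half_anticommutator_def)

lemma half_commutator_linear_right:
  assumes "x \<in> carrier A"
  shows "linear_hom A A (half_commutator x)"
proof (rule linear_homI)
  show "half_commutator x (c \<odot> y) = c \<odot> half_commutator x y" if "y \<in> carrier A" for c y
    using assms that
    by (simp add: half_commutator_def scale_mult_left scale_mult_right scale_scale mult.commute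
        flip: scale_diff_right)
qed (use assms in \<open>simp_all add: linear_space_axioms half_commutator_def l_distr r_distr
    add_diff_add scale_add_right\<close>)

lemma half_commutator_linear_left:
  "y \<in> carrier A \<Longrightarrow> linear_hom A A (\<lambda>x. half_commutator x y)"
  by (rule linear_hom_cong[OF half_commutator_linear_right[of "\<ominus> y"]])
    (simp_all add: half_commutator_minus_left)

lemma half_anticommutator_linear_right:
  assumes "x \<in> carrier A"
  shows "linear_hom A A (half_anticommutator x)"
proof (rule linear_homI)
  show "half_anticommutator x (c \<odot> y) = c \<odot> half_anticommutator x y" if "y \<in> carrier A" for c y
    using assms that
    by (simp add: half_anticommutator_def scale_mult_left scale_mult_right scale_scale mult.commute
        flip: scale_add_right)
qed (use assms in \<open>simp_all add: linear_space_axioms half_anticommutator_def l_distr r_distr M.a_ac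
    flip: scale_add_right\<close>)

lemma half_anticommutator_linear_left:
  "y \<in> carrier A \<Longrightarrow> linear_hom A A (\<lambda>x. half_anticommutator x y)"
  by (rule linear_hom_cong[OF half_anticommutator_linear_right half_anticommutator_commute])

lemma half_commutator_half_anticommutator_right:
  assumes "x \<in> carrier A" "y \<in> carrier A" "z \<in> carrier A"
  shows "half_commutator x (half_anticommutator y z) =
    half_anticommutator (half_commutator x y) z \<oplus> half_anticommutator (half_commutator x z) y"
proof -
  have "x \<otimes> (y \<otimes> z \<oplus> z \<otimes> y) \<ominus> (y \<otimes> z \<oplus> z \<otimes> y) \<otimes> x =
      ((x \<otimes> y \<ominus> y \<otimes> x) \<otimes> z \<oplus> z \<otimes> (x \<otimes> y \<ominus> y \<otimes> x))
      \<oplus> ((x \<otimes> z \<ominus> z \<otimes> x) \<otimes> y \<oplus> y \<otimes> (x \<otimes> z \<ominus> z \<otimes> x))"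
    using assms by algebra
  then show ?thesis
    using assms by (simp add: half_commutator_def half_anticommutator_def scale_mult_left
        scale_mult_right flip: scale_add_right scale_diff_right)
qed

lemma half_commutator_half_anticommutator_left:
  assumes "x \<in> carrier A" "y \<in> carrier A" "z \<in> carrier A"
  shows "half_commutator (half_anticommutator x y) z =
    half_anticommutator x (half_commutator y z) \<oplus> half_anticommutator y (half_commutator x z)"
  using half_commutator_half_anticommutator_right[of "\<ominus> z" x y] assms
  by (simp add: half_commutator_minus_left half_anticommutator_commute M.a_comm)

lemma half_anticommutator_associator:
  assumes "x \<in> carrier A" "y \<in> carrier A" "z \<in> carrier A"
  shows "half_anticommutator (half_anticommutator x y) z =
    half_anticommutator x (half_anticommutator y z) \<oplus> half_commutator y (half_commutator x z)"
proof -
  have "(x \<otimes> y \<oplus> y \<otimes> x) \<otimes> z \<oplus> z \<otimes> (x \<otimes> y \<oplus> y \<otimes> x) =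
      (x \<otimes> (y \<otimes> z \<oplus> z \<otimes> y) \<oplus> (y \<otimes> z \<oplus> z \<otimes> y) \<otimes> x)
      \<oplus> (y \<otimes> (x \<otimes> z \<ominus> z \<otimes> x) \<ominus> (x \<otimes> z \<ominus> z \<otimes> x) \<otimes> y)"
    using assms by algebra
  then show ?thesis
    using assms by (simp add: half_commutator_def half_anticommutator_def scale_mult_left
        scale_mult_right flip: scale_add_right scale_diff_right)
qed

end

context algebra_hom
begin

lemma hom_half_commutator:
  "x \<in> carrier A \<Longrightarrow> y \<in> carrier A \<Longrightarrow> h (A.half_commutator x y) = B.half_commutator (h x) (h y)"
  by (simp add: A.half_commutator_def B.half_commutator_def)

lemma hom_half_anticommutator:
  "x \<in> carrier A \<Longrightarrow> y \<in> carrier A \<Longrightarrow>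
    h (A.half_anticommutator x y) = B.half_anticommutator (h x) (h y)"
  by (simp add: A.half_anticommutator_def B.half_anticommutator_def)

lemma hom_half_supercommutator:
  "x \<in> carrier A \<Longrightarrow> y \<in> carrier A \<Longrightarrow>
    h (A.half_supercommutator i k x y) = B.half_supercommutator i k (h x) (h y)"
  by (simp add: A.half_supercommutator_def B.half_supercommutator_def)

end


section \<open>The adjoint Lie superalgebra\<close>

sublocale superalgebra \<subseteq> linear_space A
  by (intro linear_space.intro module_axioms)

context superalgebra
begin

lemma grade_closed: "x \<in> grade A i \<Longrightarrow> x \<in> carrier A"
  using linear_subspaceD(1)[OF grade_submodule] by blast

lemmas grade_zero = linear_subspaceD(2)[OF grade_submodule]
  and grade_add = linear_subspaceD(3)[OF grade_submodule]
  and grade_smult = linear_subspaceD(4)[OF grade_submodule]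
  and grade_minus = linear_subspaceD(5)[OF grade_submodule]

lemma grade_diff: "x \<in> grade A i \<Longrightarrow> y \<in> grade A i \<Longrightarrow> x \<ominus> y \<in> grade A i"
  by (simp add: M.minus_eq grade_add grade_minus)

lemma odd_mult_odd: "a \<in> grade A 1 \<Longrightarrow> b \<in> grade A 1 \<Longrightarrow> a \<otimes> b \<in> grade A 0"
  and odd_mult_even: "a \<in> grade A 1 \<Longrightarrow> x \<in> grade A 0 \<Longrightarrow> a \<otimes> x \<in> grade A 1"
  using grade_mult[of a 1 b 1] grade_mult[of a 1 x 0] by simp_all

lemmas grade_intros = grade_zero grade_add grade_smult grade_diff odd_mult_odd odd_mult_even

lemma odd_part_simps [simp]:
  "carrier (odd_part A) = grade A 1" "x \<oplus>\<^bsub>odd_part A\<^esub> y = x \<oplus> y" "c \<odot>\<^bsub>odd_part A\<^esub> x = c \<odot> x"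
  by (simp_all add: odd_part_def)

lemma odd_part_linear_space: "linear_space (odd_part A)"
  unfolding odd_part_def linear_space_def
  by (rule submodule.submodule_is_module[OF grade_submodule module_axioms])

lemma odd_part_linear_hom: "linear_hom A B f \<Longrightarrow> linear_hom (odd_part A) B f"
  using grade_closed
  by (auto intro!: linear_homI odd_part_linear_space
      simp: linear_hom.hom_closed linear_hom.hom_add linear_hom.hom_smult dest: linear_hom.axioms)

abbreviation pt :: "'a \<Rightarrow> 'a \<Rightarrow> ('a \<times> 'a \<Rightarrow>\<^sub>0 'k) set" where
  "pt \<equiv> pure_tensor (odd_part A) (odd_part A)"

abbreviation E :: "('k, ('a \<times> 'a \<Rightarrow>\<^sub>0 'k) set set) module" where
  "E \<equiv> adjoint_even A"

abbreviation FM :: "('k, 'a \<times> 'a \<Rightarrow>\<^sub>0 'k) module" where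
  "FM \<equiv> free_module (grade A 1 \<times> grade A 1)"

sublocale O: tensor_prod "odd_part A" "odd_part A"
  rewrites "tensor_product (odd_part A) (odd_part A) = odd_square A"
    and "carrier (odd_part A) = grade A 1"
  by (simp_all add: tensor_prod_def odd_part_linear_space odd_square_def)

lemma adjoint_relations_closed: "adjoint_relations A \<subseteq> carrier (odd_square A)"
proof -
  interpret S: linear_space "odd_square A" by (rule O.T.quot_linear_space)
  show ?thesis
    unfolding adjoint_relations_def Let_def by (auto simp: O.pure_tensor_closed odd_mult_even)
qed

sublocale AE: quotient_space "odd_square A" "adjoint_span A"
  rewrites "quot_alg (odd_square A) (adjoint_span A) = adjoint_even A"
proof -
  interpret S: linear_space "odd_square A" by (rule O.T.quot_linear_space)
  show "quotient_space (odd_square A) (adjoint_span A)"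
    unfolding adjoint_span_def
    by (intro quotient_space.intro quotient_space_axioms.intro S.linear_space_axioms
        S.lin_span_subspace adjoint_relations_closed)
qed (simp add: adjoint_even_def)

sublocale E: linear_space E
  by (rule AE.quot_linear_space)

lemma odot_closed: "a \<in> grade A 1 \<Longrightarrow> b \<in> grade A 1 \<Longrightarrow> odot A a b \<in> carrier E"
  by (simp add: odot_def O.pure_tensor_closed)

abbreviation odot_class :: "('a \<times> 'a \<Rightarrow>\<^sub>0 'k) \<Rightarrow> ('a \<times> 'a \<Rightarrow>\<^sub>0 'k) set set" where
  "odot_class p \<equiv> adjoint_span A +>\<^bsub>odd_square A\<^esub> (bilinear_span (odd_part A) (odd_part A) +>\<^bsub>FM\<^esub> p)"

lemma adjoint_rep:
  assumes "\<alpha> \<in> carrier E"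
  shows "adjoint_rep \<alpha> \<in> carrier FM" "odot_class (adjoint_rep \<alpha>) = \<alpha>"
proof -
  obtain C where C: "C \<in> \<alpha>" using AE.quot_nonempty[OF assms] by blast
  then obtain p where "p \<in> C"
    using O.T.quot_nonempty[OF AE.quot_memD(1)[OF assms C]] by blast
  then have "adjoint_rep \<alpha> \<in> \<Union>\<alpha>"
    unfolding adjoint_rep_def using C by (intro someI[of "\<lambda>p. p \<in> \<Union>\<alpha>"]) blast
  then obtain D where D: "D \<in> \<alpha>" "adjoint_rep \<alpha> \<in> D" by blast
  note D_mem = AE.quot_memD(1)[OF assms D(1)]
  show "adjoint_rep \<alpha> \<in> carrier FM" by (rule O.T.quot_memD(1)[OF D_mem D(2)])
  show "odot_class (adjoint_rep \<alpha>) = \<alpha>"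
    using AE.quot_memD(2)[OF assms D(1)] O.T.quot_memD(2)[OF D_mem D(2)] by simp
qed

lemma adjoint_rep_keys:
  "\<alpha> \<in> carrier E \<Longrightarrow> Poly_Mapping.keys (adjoint_rep \<alpha>) \<subseteq> grade A 1 \<times> grade A 1"
  using adjoint_rep(1)[of \<alpha>] by (simp add: O.F.finsupp_carrier)

end

definition odot_ext ::
    "('k::field, 'b, 'n) module_scheme \<Rightarrow> ('a \<Rightarrow> 'a \<Rightarrow> 'b) \<Rightarrow> ('a \<times> 'a \<Rightarrow>\<^sub>0 'k) set set \<Rightarrow> 'b" where
  "odot_ext M f \<alpha> = lin_ext M (case_prod f) (adjoint_rep \<alpha>)"

context superalgebra
begin

lemma odot_ext_mem_subspace:
  assumes "linear_space M" "linear_subspace H M" "\<alpha> \<in> carrier E"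
    and "\<And>a b. a \<in> grade A 1 \<Longrightarrow> b \<in> grade A 1 \<Longrightarrow> f a b \<in> H"
  shows "odot_ext M f \<alpha> \<in> H"
  unfolding odot_ext_def using adjoint_rep_keys[OF assms(3)] assms(4)
  by (intro linear_space.lin_ext_mem_subspace[OF assms(1,2)]) auto

lemma odot_ext_closed:
  assumes "linear_space M" "\<alpha> \<in> carrier E"
    and "\<And>a b. a \<in> grade A 1 \<Longrightarrow> b \<in> grade A 1 \<Longrightarrow> f a b \<in> carrier M"
  shows "odot_ext M f \<alpha> \<in> carrier M"
  unfolding odot_ext_def using adjoint_rep_keys[OF assms(2)] assms(3)
  by (intro linear_space.lin_ext_closed[OF assms(1)]) auto

lemma hom_odot_ext:
  assumes T: "linear_hom M N T" and \<alpha>: "\<alpha> \<in> carrier E"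
    and f: "\<And>a b. a \<in> grade A 1 \<Longrightarrow> b \<in> grade A 1 \<Longrightarrow> f a b \<in> carrier M"
    and Tf: "\<And>a b. a \<in> grade A 1 \<Longrightarrow> b \<in> grade A 1 \<Longrightarrow> T (f a b) = g a b"
  shows "T (odot_ext M f \<alpha>) = odot_ext N g \<alpha>"
proof -
  interpret T: linear_hom M N T by fact
  note keys = subsetD[OF adjoint_rep_keys[OF \<alpha>]]
  have "T (odot_ext M f \<alpha>) = lin_ext N (\<lambda>p. T (case_prod f p)) (adjoint_rep \<alpha>)"
    unfolding odot_ext_def using keys f by (intro T.hom_lin_ext) auto
  also have "\<dots> = odot_ext N g \<alpha>"
    unfolding odot_ext_def using keys f by (intro T.N.lin_ext_cong) (auto simp flip: Tf)
  finally show ?thesis .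
qed

lemma adjoint_even_lift:
  assumes bilinear: "bilinear_map (odd_part A) (odd_part A) B f"
    and commute: "\<And>a b. a \<in> grade A 1 \<Longrightarrow> b \<in> grade A 1 \<Longrightarrow> f a b = f b a"
    and balanced: "\<And>a b x. a \<in> grade A 1 \<Longrightarrow> b \<in> grade A 1 \<Longrightarrow> x \<in> grade A 0 \<Longrightarrow>
          f (a \<otimes> x) b = f a (b \<otimes> x)"
  shows "linear_hom E B (odot_ext B f)"
    and "\<And>a b. a \<in> grade A 1 \<Longrightarrow> b \<in> grade A 1 \<Longrightarrow> odot_ext B f (odot A a b) = f a b"
proof -
  note linear = bilinear_mapD(1)[OF bilinear, simplified]
  interpret B: linear_space B
    using linear[OF grade_zero] by (rule linear_hom.axioms)
  have f_closed: "f a b \<in> carrier B" if "a \<in> grade A 1" "b \<in> grade A 1" for a b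
    using linear_hom.hom_closed[OF linear[OF that(1)]] that(2) by simp
  obtain h where h: "linear_hom (odd_square A) B h" "\<And>p. p \<in> carrier FM \<Longrightarrow>
      h (bilinear_span (odd_part A) (odd_part A) +>\<^bsub>FM\<^esub> p) = lin_ext B (case_prod f) p"
    using O.tensor_product_lift[OF bilinear] by blast
  interpret h: linear_hom "odd_square A" B h by fact
  have h_pt: "h (pt a b) = f a b" if "a \<in> grade A 1" "b \<in> grade A 1" for a b
    using that by (simp add: pure_tensor_def h(2) O.single_mem_FM B.lin_ext_single f_closed)
  have "h r = \<zero>\<^bsub>B\<^esub>" if "r \<in> adjoint_relations A" for r
    using that unfolding adjoint_relations_def Let_def
    by (auto simp: O.pure_tensor_closed h_pt f_closed odd_mult_even balanced intro: commute)
  then have "h C = \<zero>\<^bsub>B\<^esub>" if "C \<in> adjoint_span A" for C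
    using h.lin_span_zero[OF adjoint_relations_closed] that unfolding adjoint_span_def by blast
  then obtain g where g: "linear_hom E B g"
    "\<And>C. C \<in> carrier (odd_square A) \<Longrightarrow> g (adjoint_span A +>\<^bsub>odd_square A\<^esub> C) = h C"
    using AE.quot_lift[OF h(1)] by blast
  have ext: "odot_ext B f \<alpha> = g \<alpha>" if \<alpha>: "\<alpha> \<in> carrier E" for \<alpha>
  proof -
    have "g \<alpha> = g (odot_class (adjoint_rep \<alpha>))" by (simp add: adjoint_rep(2)[OF \<alpha>])
    also have "\<dots> = odot_ext B f \<alpha>" by (simp add: g(2) h(2) adjoint_rep(1)[OF \<alpha>] odot_ext_def)
    finally show ?thesis by (rule sym)
  qed
  then show "linear_hom E B (odot_ext B f)" by (rule linear_hom_cong[OF g(1)])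
  show "odot_ext B f (odot A a b) = f a b" if "a \<in> grade A 1" "b \<in> grade A 1" for a b
    using that by (simp add: ext odot_closed) (simp add: odot_def g(2) h_pt O.pure_tensor_closed)
qed

lemma bracket_even_odd_eq:
  "bracket_even_odd A \<alpha> c = odot_ext A (\<lambda>a b. a \<otimes> (b \<otimes> c) \<oplus> b \<otimes> (a \<otimes> c)) \<alpha>"
  by (simp add: bracket_even_odd_def odot_ext_def)

lemma bracket_even_even_eq:
  "bracket_even_even A \<alpha> \<beta> = odot_ext E (\<lambda>a b. odot_ext E (\<lambda>c d.
     2 \<odot>\<^bsub>E\<^esub> odot A (a \<otimes> (b \<otimes> c)) d \<oplus>\<^bsub>E\<^esub> 2 \<odot>\<^bsub>E\<^esub> odot A (b \<otimes> (a \<otimes> d)) c) \<beta>) \<alpha>"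
  by (simp add: bracket_even_even_def odot_ext_def Let_def)

lemma bracket_even_odd_closed:
  "\<alpha> \<in> carrier E \<Longrightarrow> c \<in> grade A 1 \<Longrightarrow> bracket_even_odd A \<alpha> c \<in> grade A 1"
  unfolding bracket_even_odd_eq
  by (intro odot_ext_mem_subspace linear_space_axioms grade_submodule grade_intros)

lemma bracket_even_even_closed:
  "\<alpha> \<in> carrier E \<Longrightarrow> \<beta> \<in> carrier E \<Longrightarrow> bracket_even_even A \<alpha> \<beta> \<in> carrier E"
  unfolding bracket_even_even_eq
  by (intro odot_ext_closed E.linear_space_axioms E.M.a_closed E.scale_closed odot_closed
      grade_intros)

lemma adjoint_simps:
  "carrier (adjoint A) = carrier E \<times> grade A 1"
  "(\<alpha>, a) \<otimes>\<^bsub>adjoint A\<^esub> (\<beta>, b) = (bracket_even_even A \<alpha> \<beta> \<oplus>\<^bsub>E\<^esub> odot A a b,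
     bracket_even_odd A \<alpha> b \<ominus> bracket_even_odd A \<beta> a)"
  "\<zero>\<^bsub>adjoint A\<^esub> = (\<zero>\<^bsub>E\<^esub>, \<zero>)"
  "(\<alpha>, a) \<oplus>\<^bsub>adjoint A\<^esub> (\<beta>, b) = (\<alpha> \<oplus>\<^bsub>E\<^esub> \<beta>, a \<oplus> b)"
  "c \<odot>\<^bsub>adjoint A\<^esub> (\<alpha>, a) = (c \<odot>\<^bsub>E\<^esub> \<alpha>, c \<odot> a)"
  by (simp_all add: adjoint_def Let_def)

lemma adjoint_grade:
  "grade (adjoint A) i = (if i = 0 then carrier E \<times> {\<zero>} else {\<zero>\<^bsub>E\<^esub>} \<times> grade A 1)"
  by (simp add: adjoint_def Let_def)

lemma adjoint_linear_space: "linear_space (adjoint A)"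
proof (rule linear_spaceI)
  show "abelian_group (adjoint A)"
  proof (rule abelian_groupI)
    fix x assume "x \<in> carrier (adjoint A)"
    then obtain \<alpha> a where "x = (\<alpha>, a)" "\<alpha> \<in> carrier E" "a \<in> grade A 1"
      by (auto simp: adjoint_simps)
    then show "\<exists>y\<in>carrier (adjoint A). y \<oplus>\<^bsub>adjoint A\<^esub> x = \<zero>\<^bsub>adjoint A\<^esub>"
      by (intro bexI[of _ "(\<ominus>\<^bsub>E\<^esub> \<alpha>, \<ominus> a)"])
        (simp_all add: adjoint_simps grade_minus grade_closed E.M.l_neg M.l_neg)
  qed (auto simp: adjoint_simps grade_intros grade_closed E.M.a_ac M.a_ac)
qed (auto simp: adjoint_simps grade_intros grade_closed E.scale_add_left scale_add_left
    E.scale_add_right scale_add_right E.scale_scale scale_scale)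

lemma adjoint_grade_closed: "x \<in> grade (adjoint A) i \<Longrightarrow> x \<in> carrier (adjoint A)"
  by (auto simp: adjoint_simps adjoint_grade grade_zero split: if_splits)

lemma adjoint_mult_closed:
  "x \<in> carrier (adjoint A) \<Longrightarrow> y \<in> carrier (adjoint A) \<Longrightarrow> x \<otimes>\<^bsub>adjoint A\<^esub> y \<in> carrier (adjoint A)"
  by (auto simp: adjoint_simps bracket_even_even_closed bracket_even_odd_closed odot_closed
      grade_diff)

end


section \<open>Representations of Lie antialgebras in associative algebras\<close>

context lie_antialgebra
begin

lemma even_commute: "x \<in> grade A 0 \<Longrightarrow> y \<in> grade A 0 \<Longrightarrow> x \<otimes> y = y \<otimes> x"
  using supercommute[of x 0 y 0] by (simp add: koszul_sign_def mult_closed grade_closed)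

lemma odd_anticommute: "a \<in> grade A 1 \<Longrightarrow> b \<in> grade A 1 \<Longrightarrow> a \<otimes> b = \<ominus> (b \<otimes> a)"
  using supercommute[of a 1 b 1]
  by (simp add: koszul_sign_def mult_closed grade_closed scale_minus_one)

lemma odd_jacobi:
  assumes a: "a \<in> grade A 1" and b: "b \<in> grade A 1" and c: "c \<in> grade A 1"
  shows "b \<otimes> (a \<otimes> c) = a \<otimes> (b \<otimes> c) \<oplus> c \<otimes> (a \<otimes> b)"
proof -
  have closed: "p \<otimes> (q \<otimes> r) \<in> carrier A"
    if "p \<in> grade A 1" "q \<in> grade A 1" "r \<in> grade A 1" for p q r
    using that by (intro mult_closed grade_closed)
  have "b \<otimes> (c \<otimes> a) = \<ominus> (b \<otimes> (a \<otimes> c))"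
    using assms mult_smult_right[of b "a \<otimes> c" "-1"]
    by (simp add: odd_anticommute[of c a] grade_closed mult_closed flip: scale_minus_one)
  with LA3[OF a b c] have "a \<otimes> (b \<otimes> c) \<oplus> c \<otimes> (a \<otimes> b) \<ominus> b \<otimes> (a \<otimes> c) = \<zero>"
    using assms by (simp add: closed M.minus_eq M.a_ac)
  then show ?thesis using assms by (simp add: closed)
qed

end

locale antialgebra_representation = lie_antialgebra A + B: assoc_algebra B + j: linear_hom A B j
  for A :: "('k::field, 'a, 'm) superalgebra_scheme" (structure)
    and B :: "('k, 'b, 'n) module_scheme" and j +
  assumes j_odd_odd: "\<lbrakk>a \<in> grade A 1; b \<in> grade A 1\<rbrakk> \<Longrightarrow>
          B.half_commutator (j a) (j b) = j (a \<otimes> b)"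
    and j_odd_even: "\<lbrakk>a \<in> grade A 1; x \<in> grade A 0\<rbrakk> \<Longrightarrow>
          B.half_anticommutator (j a) (j x) = j (a \<otimes> x)"
    and j_even_even: "\<lbrakk>x \<in> grade A 0; y \<in> grade A 0\<rbrakk> \<Longrightarrow> j x \<otimes>\<^bsub>B\<^esub> j y = j (x \<otimes> y)"

context antialgebra_representation
begin

lemma j_closed [simp]: "x \<in> grade A i \<Longrightarrow> j x \<in> carrier B"
  by (simp add: grade_closed)

abbreviation anticomm :: "'a \<Rightarrow> 'a \<Rightarrow> 'b" where
  "anticomm a b \<equiv> B.half_anticommutator (j a) (j b)"

lemma anticomm_bilinear: "bilinear_map (odd_part A) (odd_part A) B anticomm"
  unfolding bilinear_map_def
  by (auto intro!: linear_hom_comp[OF odd_part_linear_hom[OF j.linear_hom_axioms]]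
      B.half_anticommutator_linear_left B.half_anticommutator_linear_right)

lemma anticomm_commute: "a \<in> grade A 1 \<Longrightarrow> b \<in> grade A 1 \<Longrightarrow> anticomm a b = anticomm b a"
  by (simp add: B.half_anticommutator_commute)

lemma anticomm_balanced:
  assumes a: "a \<in> grade A 1" and b: "b \<in> grade A 1" and x: "x \<in> grade A 0"
  shows "anticomm (a \<otimes> x) b = anticomm a (b \<otimes> x)"
proof -
  note ab = odd_mult_odd[OF a b]
  have "anticomm (a \<otimes> x) b = B.half_anticommutator (anticomm a x) (j b)"
    using a x by (simp add: j_odd_even)
  also have "\<dots> = B.half_anticommutator (j a) (anticomm x b)
      \<oplus>\<^bsub>B\<^esub> B.half_commutator (j x) (B.half_commutator (j a) (j b))"
    using assms by (simp add: B.half_anticommutator_associator)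
  also have "anticomm x b = j (b \<otimes> x)"
    using b x by (simp add: B.half_anticommutator_commute[of "j x"] j_odd_even)
  also have "B.half_commutator (j x) (B.half_commutator (j a) (j b))
      = B.half_commutator (j x) (j (a \<otimes> b))"
    using a b by (simp add: j_odd_odd)
  also have "\<dots> = \<zero>\<^bsub>B\<^esub>"
    using x ab by (simp add: B.half_commutator_def j_even_even even_commute[of "a \<otimes> b" x]
        grade_closed mult_closed B.M.minus_eq B.M.r_neg)
  finally show ?thesis using assms by (simp add: grade_closed mult_closed)
qed

lemma anticomm_add_left:
  assumes "a \<in> grade A 1" "b \<in> grade A 1" "c \<in> grade A 1"
  shows "anticomm (a \<oplus> b) c = anticomm a c \<oplus>\<^bsub>B\<^esub> anticomm b c"
  using linear_hom.hom_add[OF bilinear_mapD(2)[OF anticomm_bilinear]] assms by simp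

lemma half_commutator_anticomm_odd:
  assumes "a \<in> grade A 1" "b \<in> grade A 1" "c \<in> grade A 1"
  shows "B.half_commutator (anticomm a b) (j c) = j (a \<otimes> (b \<otimes> c) \<oplus> b \<otimes> (a \<otimes> c))"
  using assms
  by (simp add: B.half_commutator_half_anticommutator_left j_odd_odd j_odd_even odd_mult_odd
      grade_closed mult_closed)

lemma half_commutator_anticomm_anticomm:
  assumes a: "a \<in> grade A 1" and b: "b \<in> grade A 1" and c: "c \<in> grade A 1" and d: "d \<in> grade A 1"
  shows "B.half_commutator (anticomm a b) (anticomm c d)
    = 2 \<odot>\<^bsub>B\<^esub> anticomm (a \<otimes> (b \<otimes> c)) d \<oplus>\<^bsub>B\<^esub> 2 \<odot>\<^bsub>B\<^esub> anticomm (b \<otimes> (a \<otimes> d)) c"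
proof -
  have odd: "p \<otimes> (q \<otimes> r) \<in> grade A 1" if "p \<in> grade A 1" "q \<in> grade A 1" "r \<in> grade A 1" for p q r
    using that by (intro odd_mult_even odd_mult_odd)
  let ?X = "anticomm (a \<otimes> (b \<otimes> c)) d" and ?Y = "anticomm (a \<otimes> (b \<otimes> d)) c"
    and ?Z = "anticomm (c \<otimes> (a \<otimes> b)) d"
  have swap: "anticomm (d \<otimes> (a \<otimes> b)) c = ?Z"
    using assms anticomm_balanced[of d c "a \<otimes> b"] anticomm_commute[of d]
    by (simp add: odd odd_mult_odd)
  have X: "anticomm (b \<otimes> (a \<otimes> c)) d = ?X \<oplus>\<^bsub>B\<^esub> ?Z"
    using assms by (simp only: odd_jacobi[OF a b c] anticomm_add_left odd)
  have Y: "anticomm (b \<otimes> (a \<otimes> d)) c = ?Y \<oplus>\<^bsub>B\<^esub> ?Z"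
    using assms by (simp only: odd_jacobi[OF a b d] anticomm_add_left odd swap)
  have "B.half_commutator (anticomm a b) (anticomm c d)
      = anticomm (a \<otimes> (b \<otimes> c) \<oplus> b \<otimes> (a \<otimes> c)) d \<oplus>\<^bsub>B\<^esub> anticomm (a \<otimes> (b \<otimes> d) \<oplus> b \<otimes> (a \<otimes> d)) c"
    using assms by (simp only: B.half_commutator_half_anticommutator_right
        half_commutator_anticomm_odd j_closed B.half_anticommutator_closed)
  also have "\<dots> = (?X \<oplus>\<^bsub>B\<^esub> (?X \<oplus>\<^bsub>B\<^esub> ?Z)) \<oplus>\<^bsub>B\<^esub> (?Y \<oplus>\<^bsub>B\<^esub> (?Y \<oplus>\<^bsub>B\<^esub> ?Z))"
    using assms by (simp only: anticomm_add_left odd X Y)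
  also have "\<dots> = (?X \<oplus>\<^bsub>B\<^esub> ?X) \<oplus>\<^bsub>B\<^esub> ((?Y \<oplus>\<^bsub>B\<^esub> ?Z) \<oplus>\<^bsub>B\<^esub> (?Y \<oplus>\<^bsub>B\<^esub> ?Z))"
    using assms by (simp add: grade_closed mult_closed B.M.a_ac)
  also have "\<dots> = 2 \<odot>\<^bsub>B\<^esub> ?X \<oplus>\<^bsub>B\<^esub> 2 \<odot>\<^bsub>B\<^esub> (?Y \<oplus>\<^bsub>B\<^esub> ?Z)"
    using assms by (simp add: grade_closed mult_closed B.scale_two)
  finally show ?thesis by (simp only: Y)
qed

definition even_map :: "('a \<times> 'a \<Rightarrow>\<^sub>0 'k) set set \<Rightarrow> 'b" where
  "even_map = odot_ext B anticomm"

sublocale even: linear_hom E B even_map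
  unfolding even_map_def
  by (rule adjoint_even_lift(1)[OF anticomm_bilinear anticomm_commute anticomm_balanced])

lemma even_map_odot: "a \<in> grade A 1 \<Longrightarrow> b \<in> grade A 1 \<Longrightarrow> even_map (odot A a b) = anticomm a b"
  unfolding even_map_def
  by (rule adjoint_even_lift(2)[OF anticomm_bilinear anticomm_commute anticomm_balanced])

lemma hom_even_map:
  assumes "linear_hom B B T" "\<alpha> \<in> carrier E"
  shows "T (even_map \<alpha>) = odot_ext B (\<lambda>a b. T (anticomm a b)) \<alpha>"
  unfolding even_map_def by (rule hom_odot_ext[OF assms]) simp_all

lemma j_bracket_even_odd:
  assumes \<alpha>: "\<alpha> \<in> carrier E" and c: "c \<in> grade A 1"
  shows "j (bracket_even_odd A \<alpha> c) = B.half_commutator (even_map \<alpha>) (j c)"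
proof -
  have "j (bracket_even_odd A \<alpha> c) = odot_ext B (\<lambda>a b. B.half_commutator (anticomm a b) (j c)) \<alpha>"
    unfolding bracket_even_odd_eq using c
    by (intro hom_odot_ext[OF j.linear_hom_axioms \<alpha>])
      (simp_all add: half_commutator_anticomm_odd grade_closed mult_closed)
  also have "\<dots> = B.half_commutator (even_map \<alpha>) (j c)"
    using c by (intro hom_even_map[OF _ \<alpha>, symmetric] B.half_commutator_linear_left) simp
  finally show ?thesis .
qed

lemma even_map_bracket_even_even:
  assumes \<alpha>: "\<alpha> \<in> carrier E" and \<beta>: "\<beta> \<in> carrier E"
  shows "even_map (bracket_even_even A \<alpha> \<beta>) = B.half_commutator (even_map \<alpha>) (even_map \<beta>)"
proof -
  let ?G = "\<lambda>a b c d. 2 \<odot>\<^bsub>E\<^esub> odot A (a \<otimes> (b \<otimes> c)) d \<oplus>\<^bsub>E\<^esub> 2 \<odot>\<^bsub>E\<^esub> odot A (b \<otimes> (a \<otimes> d)) c"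
  have G_closed: "?G a b c d \<in> carrier E"
    if "a \<in> grade A 1" "b \<in> grade A 1" "c \<in> grade A 1" "d \<in> grade A 1" for a b c d
    using that by (intro E.M.a_closed E.scale_closed odot_closed grade_intros)
  have inner: "even_map (odot_ext E (?G a b) \<beta>) = B.half_commutator (anticomm a b) (even_map \<beta>)"
    if a: "a \<in> grade A 1" and b: "b \<in> grade A 1" for a b
  proof -
    have "even_map (odot_ext E (?G a b) \<beta>)
        = odot_ext B (\<lambda>c d. B.half_commutator (anticomm a b) (anticomm c d)) \<beta>"
      using a b by (intro hom_odot_ext[OF even.linear_hom_axioms \<beta>] G_closed)
        (simp_all add: half_commutator_anticomm_anticomm even_map_odot odot_closed grade_intros)
    also have "\<dots> = B.half_commutator (anticomm a b) (even_map \<beta>)"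
      using a b by (intro hom_even_map[OF _ \<beta>, symmetric] B.half_commutator_linear_right) simp
    finally show ?thesis .
  qed
  have "even_map (bracket_even_even A \<alpha> \<beta>)
      = odot_ext B (\<lambda>a b. B.half_commutator (anticomm a b) (even_map \<beta>)) \<alpha>"
    unfolding bracket_even_even_eq
    by (intro hom_odot_ext[OF even.linear_hom_axioms \<alpha>] inner odot_ext_closed
        E.linear_space_axioms \<beta> G_closed)
  also have "\<dots> = B.half_commutator (even_map \<alpha>) (even_map \<beta>)"
    using \<beta> by (intro hom_even_map[OF _ \<alpha>, symmetric] B.half_commutator_linear_left) simp
  finally show ?thesis .
qed

definition adjoint_map :: "('a \<times> 'a \<Rightarrow>\<^sub>0 'k) set set \<times> 'a \<Rightarrow> 'b" where
  "adjoint_map = (\<lambda>(\<alpha>, a). even_map \<alpha> \<oplus>\<^bsub>B\<^esub> j a)"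

lemma adjoint_map_linear: "linear_hom (adjoint A) B adjoint_map"
  by (rule linear_homI[OF adjoint_linear_space B.linear_space_axioms])
    (auto simp: adjoint_simps adjoint_map_def grade_closed B.scale_add_right B.M.a_ac)

lemma adjoint_map_even: "\<alpha> \<in> carrier E \<Longrightarrow> adjoint_map (\<alpha>, \<zero>) = even_map \<alpha>"
  by (simp add: adjoint_map_def)

lemma adjoint_map_odd: "a \<in> grade A 1 \<Longrightarrow> adjoint_map (\<zero>\<^bsub>E\<^esub>, a) = j a"
  by (simp add: adjoint_map_def)

lemma adjoint_map_mult:
  assumes "\<alpha> \<in> carrier E" "a \<in> grade A 1" "\<beta> \<in> carrier E" "b \<in> grade A 1"
  shows "adjoint_map ((\<alpha>, a) \<otimes>\<^bsub>adjoint A\<^esub> (\<beta>, b)) =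
    (B.half_commutator (even_map \<alpha>) (even_map \<beta>) \<oplus>\<^bsub>B\<^esub> anticomm a b) \<oplus>\<^bsub>B\<^esub>
    (B.half_commutator (even_map \<alpha>) (j b) \<ominus>\<^bsub>B\<^esub> B.half_commutator (even_map \<beta>) (j a))"
  using assms
  by (simp add: adjoint_simps adjoint_map_def even_map_bracket_even_even j_bracket_even_odd
      even_map_odot bracket_even_even_closed bracket_even_odd_closed[THEN grade_closed] odot_closed
      grade_closed)

lemma adjoint_map_bracket:
  assumes x: "x \<in> grade (adjoint A) i" and y: "y \<in> grade (adjoint A) k"
  shows "B.half_supercommutator i k (adjoint_map x) (adjoint_map y) = adjoint_map (x \<otimes>\<^bsub>adjoint A\<^esub> y)"
proof -
  consider "i = 0" "k = 0" | "i = 0" "k = 1" | "i = 1" "k = 0" | "i = 1" "k = 1"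
    by (metis bit_not_one_iff)
  then show ?thesis
    by cases (use x y in \<open>auto simp: adjoint_grade adjoint_map_mult adjoint_map_even
        adjoint_map_odd grade_zero B.half_supercommutator_simps B.M.minus_eq
        B.half_commutator_antisym[of "j a" "even_map \<alpha>" for a \<alpha>]\<close>)
qed

lemma generated_by_odd:
  assumes span: "grade A 0 = lin_span A {a \<otimes> b | a b. a \<in> grade A 1 \<and> b \<in> grade A 1}"
    and H: "assoc_subalgebra H B" and odd: "j ` grade A 1 \<subseteq> H"
  shows "j ` carrier A \<subseteq> H"
proof -
  note H_subspace = linear_subspaceD[OF assoc_subalgebra_subspace[OF H]]
    and H_mult = submonoid.m_closed[OF assoc_subalgebra_submonoid[OF H]]
  have "j (a \<otimes> b) \<in> H" if ab: "a \<in> grade A 1" "b \<in> grade A 1" for a b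
  proof -
    have "j a \<in> H" "j b \<in> H" using odd ab by blast+
    then have "B.half_commutator (j a) (j b) \<in> H"
      unfolding B.half_commutator_def B.M.minus_eq by (intro H_subspace(3-5) H_mult)
    then show ?thesis by (simp add: j_odd_odd ab)
  qed
  then have even: "j ` grade A 0 \<subseteq> H"
    unfolding span
    by (intro j.image_lin_span_subset assoc_subalgebra_subspace[OF H])
      (auto simp: grade_closed mult_closed)
  show ?thesis
  proof
    fix y assume "y \<in> j ` carrier A"
    then obtain x where "x \<in> carrier A" "y = j x" by blast
    moreover then obtain x\<^sub>0 x\<^sub>1 where "x\<^sub>0 \<in> grade A 0" "x\<^sub>1 \<in> grade A 1" "x = x\<^sub>0 \<oplus> x\<^sub>1"
      using grade_sum by blast
    ultimately show "y \<in> H" using even odd by (auto simp: grade_closed intro!: H_subspace(3))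
  qed
qed

end


section \<open>Enveloping algebras\<close>

lemma lie_enveloping_eq: "lie_enveloping G = presented_algebra G (lie_relations G)"
  by (simp add: lie_enveloping_def presented_algebra_def)

lemma antialgebra_enveloping_eq:
  "antialgebra_enveloping A = presented_algebra A (antialgebra_relations A)"
  by (simp add: antialgebra_enveloping_def presented_algebra_def)

context superalgebra
begin

lemma presented_alg_antialgebra: "presented_alg A (antialgebra_relations A)"
proof -
  interpret T: tensor_alg A by (intro tensor_alg.intro linear_space_axioms)
  interpret \<iota>: linear_hom A T.TA "tensor_emb A" by (rule T.tensor_emb_linear)
  show ?thesis
    by (intro presented_alg.intro T.tensor_alg_axioms presented_alg_axioms.intro)
      (auto simp: antialgebra_relations_def Let_def grade_closed mult_closed)
qed

lemma presented_alg_adjoint: "presented_alg (adjoint A) (lie_relations (adjoint A))"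
proof -
  interpret T: tensor_alg "adjoint A" by (intro tensor_alg.intro adjoint_linear_space)
  interpret \<iota>: linear_hom "adjoint A" T.TA "tensor_emb (adjoint A)" by (rule T.tensor_emb_linear)
  show ?thesis
    by (intro presented_alg.intro T.tensor_alg_axioms presented_alg_axioms.intro)
      (auto simp: lie_relations_def Let_def adjoint_mult_closed dest!: adjoint_grade_closed)
qed

end

lemma (in lie_antialgebra) antialgebra_representation_presented_emb:
  "antialgebra_representation A (antialgebra_enveloping A)
     (presented_emb A (antialgebra_relations A))"
proof -
  interpret U: presented_alg A "antialgebra_relations A" by (rule presented_alg_antialgebra)
  interpret \<iota>: linear_hom A U.TA "tensor_emb A" by (rule U.tensor_emb_linear)
  let ?\<iota> = "tensor_emb A" and ?u = "presented_emb A (antialgebra_relations A)"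
  note relation_simps = antialgebra_relations_def Let_def U.cls.B.half_commutator_def
    U.cls.B.half_anticommutator_def grade_closed mult_closed
  show ?thesis
    unfolding antialgebra_enveloping_eq
  proof (intro antialgebra_representation.intro antialgebra_representation_axioms.intro
      lie_antialgebra_axioms U.pcls.B.assoc_algebra_axioms U.presented_emb_linear)
    fix a b assume ab: "a \<in> grade A 1" "b \<in> grade A 1"
    have "U.pcls.B.half_commutator (?u a) (?u b)
        = U.presented_class (U.cls.B.half_commutator (?\<iota> a) (?\<iota> b))"
      using ab by (simp add: presented_emb_def U.pcls.hom_half_commutator grade_closed)
    also have "\<dots> = ?u (a \<otimes> b)"
      unfolding presented_emb_def using ab
      by (intro U.presented_class_eq) (auto simp: relation_simps)
    finally show "U.pcls.B.half_commutator (?u a) (?u b) = ?u (a \<otimes> b)" .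
  next
    fix a x assume ax: "a \<in> grade A 1" "x \<in> grade A 0"
    have "U.pcls.B.half_anticommutator (?u a) (?u x)
        = U.presented_class (U.cls.B.half_anticommutator (?\<iota> a) (?\<iota> x))"
      using ax by (simp add: presented_emb_def U.pcls.hom_half_anticommutator grade_closed)
    also have "\<dots> = ?u (a \<otimes> x)"
      unfolding presented_emb_def using ax
      by (intro U.presented_class_eq) (auto simp: relation_simps)
    finally show "U.pcls.B.half_anticommutator (?u a) (?u x) = ?u (a \<otimes> x)" .
  next
    fix x y assume xy: "x \<in> grade A 0" "y \<in> grade A 0"
    have "?u x \<otimes>\<^bsub>U.PA\<^esub> ?u y = U.presented_class (?\<iota> x \<otimes>\<^bsub>U.TA\<^esub> ?\<iota> y)"
      using xy by (simp add: presented_emb_def grade_closed)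
    also have "\<dots> = ?u (x \<otimes> y)"
      unfolding presented_emb_def using xy
      by (intro U.presented_class_eq) (auto simp: relation_simps)
    finally show "?u x \<otimes>\<^bsub>U.PA\<^esub> ?u y = ?u (x \<otimes> y)" .
  qed
qed

lemma (in antialgebra_representation) lie_enveloping_adjoint_lift:
  obtains h where "algebra_hom (lie_enveloping (adjoint A)) B h"
    and "j ` grade A 1 \<subseteq> h ` carrier (lie_enveloping (adjoint A))"
proof -
  let ?G = "adjoint A" and ?R = "lie_relations (adjoint A)"
  interpret G: presented_alg ?G ?R by (rule presented_alg_adjoint)
  interpret \<iota>: linear_hom ?G G.TA "tensor_emb ?G" by (rule G.tensor_emb_linear)
  interpret u: linear_hom ?G G.PA "presented_emb ?G ?R" by (rule G.presented_emb_linear)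
  interpret \<phi>: linear_hom ?G B adjoint_map by (rule adjoint_map_linear)
  obtain h where h: "algebra_hom G.PA B h"
    "\<And>x. x \<in> carrier ?G \<Longrightarrow> h (presented_emb ?G ?R x) = adjoint_map x"
  proof (rule G.presented_lift[OF B.assoc_algebra_axioms adjoint_map_linear])
    fix h r assume "algebra_hom G.TA B h" and r: "r \<in> ?R"
      and h_emb: "\<And>x. x \<in> carrier ?G \<Longrightarrow> h (tensor_emb ?G x) = adjoint_map x"
    then interpret h: algebra_hom G.TA B h by blast
    obtain i k x y where xy: "x \<in> grade ?G i" "y \<in> grade ?G k"
      and r_eq: "r = G.cls.B.half_supercommutator i k (tensor_emb ?G x) (tensor_emb ?G y)
        \<ominus>\<^bsub>G.TA\<^esub> tensor_emb ?G (x \<otimes>\<^bsub>?G\<^esub> y)"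
      using r unfolding lie_relations_def Let_def G.cls.B.half_supercommutator_def by blast
    note closed = xy[THEN adjoint_grade_closed] adjoint_mult_closed
    have "h r = B.half_supercommutator i k (adjoint_map x) (adjoint_map y)
        \<ominus>\<^bsub>B\<^esub> adjoint_map (x \<otimes>\<^bsub>?G\<^esub> y)"
      by (simp add: r_eq h_emb h.hom_half_supercommutator closed)
    then show "h r = \<zero>\<^bsub>B\<^esub>"
      by (simp add: adjoint_map_bracket[OF xy] closed)
  qed blast
  have "j a \<in> h ` carrier G.PA" if a: "a \<in> grade A 1" for a
  proof (rule image_eqI)
    have odd: "(\<zero>\<^bsub>E\<^esub>, a) \<in> carrier ?G" using a by (simp add: adjoint_simps)
    then show "presented_emb ?G ?R (\<zero>\<^bsub>E\<^esub>, a) \<in> carrier G.PA" by simp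
    show "j a = h (presented_emb ?G ?R (\<zero>\<^bsub>E\<^esub>, a))"
      using a by (simp add: h(2)[OF odd] adjoint_map_odd)
  qed
  then show thesis using h(1) by (intro that) (auto simp: lie_enveloping_eq)
qed

theorem theorem2:
  fixes A :: "('k::field, 'a) superalgebra"
  assumes "(ring_of_type_algebra :: 'k ring) \<simeq> (ring_of_type_algebra :: real ring) \<or>
           (ring_of_type_algebra :: 'k ring) \<simeq> (ring_of_type_algebra :: complex ring)"
    and "lie_antialgebra A"
    and "grade A 0 = lin_span A {a \<otimes>\<^bsub>A\<^esub> b | a b. a \<in> grade A 1 \<and> b \<in> grade A 1}"
  shows "\<exists>I. ideal I (lie_enveloping (adjoint A)) \<and>
             (\<exists>h. h \<in> alg_iso (antialgebra_enveloping A) (quot_alg (lie_enveloping (adjoint A)) I))"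
proof -
  interpret lie_antialgebra A by fact
  interpret U: presented_alg A "antialgebra_relations A" by (rule presented_alg_antialgebra)
  interpret u: antialgebra_representation A "antialgebra_enveloping A"
      "presented_emb A (antialgebra_relations A)"
    by (rule antialgebra_representation_presented_emb)
  obtain h where "algebra_hom (lie_enveloping (adjoint A)) (antialgebra_enveloping A) h"
    and odd: "presented_emb A (antialgebra_relations A) ` grade A 1
      \<subseteq> h ` carrier (lie_enveloping (adjoint A))"
    by (rule u.lie_enveloping_adjoint_lift)
  then interpret h: algebra_hom "lie_enveloping (adjoint A)" "antialgebra_enveloping A" h by blast
  have "carrier (antialgebra_enveloping A) \<subseteq> h ` carrier (lie_enveloping (adjoint A))"
    using U.presented_algebra_generated[folded antialgebra_enveloping_eq, OF h.image_subalgebra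
        u.generated_by_odd[OF assms(3) h.image_subalgebra odd]] .
  then have "h ` carrier (lie_enveloping (adjoint A)) = carrier (antialgebra_enveloping A)"
    by auto
  then show ?thesis
    by (rule h.first_isomorphism) blast
qed

end
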